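(* Let $m\ge1$ be an integer, let $T$ be an $m\times m$ matrix with integer entries and $\det T\ne0$, and let $r\ge1$ be an integer. If $G=G(m,T)$ has exponential growth, then for every finite generating set $Y$ of $G$, the set $$\mathcal{N}_r(G)=\{(x_0,\ldots,x_r)\in G^{r+1}\mid [x_0,\ldots,x_r]=1\}$$ is exponentially negligible in $G^{r+1}$ with respect to $Y$.
   Context: For $m\ge 1$ and an $m\times m$ integer matrix $T$ with $\det T\neq0$, the group $G(m,T)$ is given by the presentation with generators $a_1,\ldots,a_m,t$ and relations $a_ia_j=a_ja_i$ for $1\le i<j\le m$ and $t\mathbf{a}^{\mathbf{u}}t^{-1}=\mathbf{a}^{T\mathbf{u}}$ for all $\mathbf{u}\in\mathbb{Z}^m$, where $\mathbf{a}^{\mathbf{v}}=a_1^{v_1}\cdots a_m^{v_m}$ for $\mathbf{v}=(v_1,\ldots,v_m)\in\mathbb{Z}^m$. Commutators: $[x_0,x_1]=x_0^{-1}x_1^{-1}x_0x_1$ and inductively $[x_0,\ldots,x_r]=[[x_0,\ldots,x_{r-1}],x_r]$. For a finite generating set $Y$ of a group $G$, let $|g|_Y$ be the minimal length of a word in the elements of $Y$ and their inverses representing $g\in G$, and for $n \in \mathbb{Z}_{\ge 0}$ let $B_Y(n)=\{g\in G \mid |g|_Y\le n\}$. The group $G$ has exponential growth if $\liminf_{n\to\infty}\sqrt[n]{|B_Y(n)|}>1$ for some (equivalently, every) finite generating set $Y$. For an integer $s\ge1$, a subset $\mathcal{A}\subseteq G^s$ is exponentially negligible in $G^s$ with respect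 to $Y$ if $$\limsup_{n\to\infty}\sqrt[n]{\frac{|\mathcal{A}\cap B_Y(n)^s|}{|B_Y(n)|^s}}<1.$$ *)

theory Defs
  imports
    "HOL-Algebra.Generated_Groups"
    "HOL-Library.Extended_Real"
    "HOL-Library.FuncSet"
    "Jordan_Normal_Form.Determinant"
begin

section \<open>Group words\<close>

text \<open>A letter \<open>(x, True)\<close> stands for \<open>x\<close>, and \<open>(x, False)\<close> stands for the inverse of \<open>x\<close>.\<close>

type_synonym 'a gword = "('a \<times> bool) list"

definition gwords :: "'a set \<Rightarrow> 'a gword set" where
  "gwords S = lists (S \<times> UNIV)"

definition gword_inv :: "'a gword \<Rightarrow> 'a gword" where
  "gword_inv w = rev (map (\<lambda>(x, b). (x, \<not> b)) w)"

primrec eval_gword :: "('b, 'c) monoid_scheme \<Rightarrow> ('a \<Rightarrow> 'b) \<Rightarrow> 'a gword \<Rightarrow> 'b" where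
  "eval_gword G f [] = \<one>\<^bsub>G\<^esub>"
| "eval_gword G f (l # w) =
     (if snd l then f (fst l) else inv\<^bsub>G\<^esub> (f (fst l))) \<otimes>\<^bsub>G\<^esub> eval_gword G f w"


section \<open>Groups given by a presentation\<close>

text \<open>
  A relation \<open>u = v\<close> is a pair \<open>(u, v)\<close> of words. The group with generators \<open>S\<close> and
  relations \<open>R\<close> consists of the classes of words over \<open>S\<close> modulo the least congruence
  (for concatenation) containing \<open>R\<close> and the free cancellations. The lemmas
  \<open>presented_group_is_group\<close> and \<open>presented_group_universal\<close> below confirm that this
  is the group defined by the presentation.
\<close>

inductive pres_eq :: "'a set \<Rightarrow> ('a gword \<times> 'a gword) set \<Rightarrow> 'a gword \<Rightarrow> 'a gword \<Rightarrow> bool"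
  for S :: "'a set" and R :: "('a gword \<times> 'a gword) set" where
  pres_refl: "w \<in> gwords S \<Longrightarrow> pres_eq S R w w"
| pres_sym: "pres_eq S R u v \<Longrightarrow> pres_eq S R v u"
| pres_trans: "pres_eq S R u v \<Longrightarrow> pres_eq S R v w \<Longrightarrow> pres_eq S R u w"
| pres_append: "pres_eq S R u v \<Longrightarrow> pres_eq S R u' v' \<Longrightarrow> pres_eq S R (u @ u') (v @ v')"
| pres_cancel: "x \<in> S \<Longrightarrow> pres_eq S R [(x, b), (x, \<not> b)] []"
| pres_rel: "(u, v) \<in> R \<Longrightarrow> u \<in> gwords S \<Longrightarrow> v \<in> gwords S \<Longrightarrow> pres_eq S R u v"

definition pres_class :: "'a set \<Rightarrow> ('a gword \<times> 'a gword) set \<Rightarrow> 'a gword \<Rightarrow> 'a gword set" where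
  "pres_class S R w = {v. pres_eq S R w v}"

definition presented_group :: "'a set \<Rightarrow> ('a gword \<times> 'a gword) set \<Rightarrow> 'a gword set monoid" where
  "presented_group S R =
     \<lparr>carrier = pres_class S R ` gwords S,
      monoid.mult = (\<lambda>X Y. \<Union>u\<in>X. \<Union>v\<in>Y. pres_class S R (u @ v)),
      monoid.one = pres_class S R []\<rparr>"

lemma gwords_Nil [simp]: "[] \<in> gwords S"
  and gwords_Cons [simp]: "l # w \<in> gwords S \<longleftrightarrow> fst l \<in> S \<and> w \<in> gwords S"
  and gwords_append [simp]: "u @ v \<in> gwords S \<longleftrightarrow> u \<in> gwords S \<and> v \<in> gwords S"
  by (auto simp: gwords_def mem_Times_iff)

lemma gword_inv_closed [simp]: "w \<in> gwords S \<Longrightarrow> gword_inv w \<in> gwords S"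
  by (induction w) (auto simp: gword_inv_def)

lemma pres_eq_closed: "pres_eq S R u v \<Longrightarrow> u \<in> gwords S \<and> v \<in> gwords S"
  by (induction rule: pres_eq.induct) auto

lemma pres_class_eq_iff:
  assumes "u \<in> gwords S"
  shows "pres_class S R u = pres_class S R v \<longleftrightarrow> pres_eq S R u v"
proof
  assume "pres_class S R u = pres_class S R v"
  then have "pres_eq S R v u"
    using pres_refl[OF assms] by (auto simp: pres_class_def)
  then show "pres_eq S R u v" by (rule pres_sym)
next
  assume "pres_eq S R u v"
  then show "pres_class S R u = pres_class S R v"
    using pres_trans[of S R u v] pres_trans[of S R v u] pres_sym[of S R u v]
    unfolding pres_class_def by blast
qed

lemma pres_class_mult:
  assumes "u \<in> gwords S" "v \<in> gwords S"
  shows "pres_class S R u \<otimes>\<^bsub>presented_group S R\<^esub> pres_class S R v = pres_class S R (u @ v)"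
proof -
  have *: "pres_class S R (u' @ v') = pres_class S R (u @ v)"
    if "u' \<in> pres_class S R u" "v' \<in> pres_class S R v" for u' v'
  proof -
    have "pres_eq S R (u @ v) (u' @ v')"
      using that pres_append[of S R u u' v v'] by (simp add: pres_class_def)
    then show ?thesis
      using assms pres_class_eq_iff[of "u @ v" S R "u' @ v'"] by simp
  qed
  have "u \<in> pres_class S R u" "v \<in> pres_class S R v"
    using assms by (auto simp: pres_class_def intro: pres_refl)
  then have "(\<Union>u'\<in>pres_class S R u. \<Union>v'\<in>pres_class S R v. pres_class S R (u' @ v')) =
      pres_class S R (u @ v)"
    using * by blast
  then show ?thesis
    by (simp add: presented_group_def)
qed

lemma pres_inv_left: "w \<in> gwords S \<Longrightarrow> pres_eq S R (gword_inv w @ w) []"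
proof (induction w)
  case Nil
  then show ?case by (auto simp: gword_inv_def intro: pres_refl)
next
  case (Cons l w)
  obtain x b where l: "l = (x, b)" by fastforce
  have w: "w \<in> gwords S" and x: "x \<in> S" using Cons.prems l by auto
  have "pres_eq S R [(x, \<not> b), (x, b)] []"
    using pres_cancel[OF x, of R "\<not> b"] by simp
  then have "pres_eq S R (gword_inv w @ ([(x, \<not> b), (x, b)] @ w)) (gword_inv w @ ([] @ w))"
    using w by (intro pres_append pres_refl) auto
  then have "pres_eq S R (gword_inv w @ ([(x, \<not> b), (x, b)] @ w)) []"
    using Cons.IH[OF w] by (auto intro: pres_trans)
  then show ?case by (simp add: l gword_inv_def)
qed

lemma presented_group_is_group: "group (presented_group S R)"
proof (rule groupI)
  let ?G = "presented_group S R"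
  have carr: "carrier ?G = pres_class S R ` gwords S"
    and one: "\<one>\<^bsub>?G\<^esub> = pres_class S R []"
    by (simp_all add: presented_group_def)
  show "\<one>\<^bsub>?G\<^esub> \<in> carrier ?G" by (auto simp: carr one)
  fix X assume X: "X \<in> carrier ?G"
  then obtain u where u: "u \<in> gwords S" "X = pres_class S R u" by (auto simp: carr)
  show "\<one>\<^bsub>?G\<^esub> \<otimes>\<^bsub>?G\<^esub> X = X" using u by (simp add: one pres_class_mult)
  have "pres_class S R (gword_inv u @ u) = pres_class S R []"
    using u by (subst pres_class_eq_iff) (auto intro: pres_inv_left)
  then show "\<exists>Y\<in>carrier ?G. Y \<otimes>\<^bsub>?G\<^esub> X = \<one>\<^bsub>?G\<^esub>"
    using u by (auto simp: carr one pres_class_mult intro!: bexI[of _ "gword_inv u"])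
  fix Y assume Y: "Y \<in> carrier ?G"
  then show "X \<otimes>\<^bsub>?G\<^esub> Y \<in> carrier ?G" using u by (auto simp: carr pres_class_mult)
  fix Z assume "Z \<in> carrier ?G"
  then show "X \<otimes>\<^bsub>?G\<^esub> Y \<otimes>\<^bsub>?G\<^esub> Z = X \<otimes>\<^bsub>?G\<^esub> (Y \<otimes>\<^bsub>?G\<^esub> Z)"
    using u Y by (auto simp: carr pres_class_mult)
qed

lemma eval_gword_closed:
  assumes "group H" "f \<in> S \<rightarrow> carrier H" "w \<in> gwords S"
  shows "eval_gword H f w \<in> carrier H"
proof -
  interpret group H by fact
  show ?thesis using assms(2,3) by (induction w) auto
qed

lemma eval_gword_append:
  assumes "group H" "f \<in> S \<rightarrow> carrier H" "u \<in> gwords S" "v \<in> gwords S"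
  shows "eval_gword H f (u @ v) = eval_gword H f u \<otimes>\<^bsub>H\<^esub> eval_gword H f v"
proof -
  interpret group H by fact
  show ?thesis using assms(2,3,4)
    by (induction u) (auto simp: m_assoc Pi_iff eval_gword_closed[OF assms(1,2)])
qed

lemma presented_group_universal:
  assumes H: "group H" and f: "f \<in> S \<rightarrow> carrier H"
    and R: "\<And>u v. (u, v) \<in> R \<Longrightarrow> u \<in> gwords S \<Longrightarrow> v \<in> gwords S \<Longrightarrow>
                   eval_gword H f u = eval_gword H f v"
  shows "\<exists>h \<in> hom (presented_group S R) H.
           \<forall>w \<in> gwords S. h (pres_class S R w) = eval_gword H f w"
proof -
  interpret group H by fact
  have ev: "eval_gword H f u = eval_gword H f v" if "pres_eq S R u v" for u v
    using that
  proof (induction rule: pres_eq.induct)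
    case (pres_append u v u' v')
    then show ?case
      using pres_eq_closed[OF pres_append.hyps(1)] pres_eq_closed[OF pres_append.hyps(2)]
      by (simp add: eval_gword_append[OF H f])
  next
    case (pres_cancel x b)
    then show ?case using f by (cases b) (auto simp: Pi_iff)
  qed (auto simp: R)
  define h where "h X = eval_gword H f (SOME w. w \<in> X)" for X
  have h: "h (pres_class S R w) = eval_gword H f w" if "w \<in> gwords S" for w
  proof -
    have "w \<in> pres_class S R w" using that by (auto simp: pres_class_def intro: pres_refl)
    then have "(SOME v. v \<in> pres_class S R w) \<in> pres_class S R w" by (rule someI)
    then show ?thesis unfolding h_def using ev by (simp add: pres_class_def)
  qed
  have carr: "carrier (presented_group S R) = pres_class S R ` gwords S"
    by (simp add: presented_group_def)
  have "h \<in> hom (presented_group S R) H"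
    by (rule homI)
      (auto simp: carr h pres_class_mult eval_gword_closed[OF H f] eval_gword_append[OF H f])
  then show ?thesis using h by blast
qed


section \<open>The groups \<open>G(m, T)\<close>\<close>

text \<open>
  Indices run over \<open>0, \<dots>, m - 1\<close>, following the convention of the matrix library.
\<close>

datatype GmT_gen = Gen_a nat | Gen_t

definition GmT_gens :: "nat \<Rightarrow> GmT_gen set" where
  "GmT_gens m = insert Gen_t (Gen_a ` {..<m})"

definition gen_zpow :: "'a \<Rightarrow> int \<Rightarrow> 'a gword" where
  "gen_zpow x k = replicate (nat \<bar>k\<bar>) (x, 0 \<le> k)"

definition a_pow :: "int vec \<Rightarrow> GmT_gen gword" where
  "a_pow v = concat (map (\<lambda>i. gen_zpow (Gen_a i) (v $ i)) [0..<dim_vec v])"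

definition GmT_rels :: "nat \<Rightarrow> int mat \<Rightarrow> (GmT_gen gword \<times> GmT_gen gword) set" where
  "GmT_rels m T =
     {([(Gen_a i, True), (Gen_a j, True)], [(Gen_a j, True), (Gen_a i, True)]) | i j.
        i < j \<and> j < m} \<union>
     {([(Gen_t, True)] @ a_pow u @ [(Gen_t, False)], a_pow (T *\<^sub>v u)) | u.
        u \<in> carrier_vec m}"

definition GmT :: "nat \<Rightarrow> int mat \<Rightarrow> GmT_gen gword set monoid" where
  "GmT m T = presented_group (GmT_gens m) (GmT_rels m T)"


section \<open>Word length, balls and growth\<close>

definition finite_generating_set :: "('a, 'b) monoid_scheme \<Rightarrow> 'a set \<Rightarrow> bool" where
  "finite_generating_set G Y \<longleftrightarrow> finite Y \<and> Y \<subseteq> carrier G \<and> generate G Y = carrier G"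

definition word_length :: "('a, 'b) monoid_scheme \<Rightarrow> 'a set \<Rightarrow> 'a \<Rightarrow> nat" where
  "word_length G Y g = (LEAST n. \<exists>w \<in> gwords Y. length w = n \<and> eval_gword G (\<lambda>y. y) w = g)"

definition word_ball :: "('a, 'b) monoid_scheme \<Rightarrow> 'a set \<Rightarrow> nat \<Rightarrow> 'a set" where
  "word_ball G Y n = {g \<in> carrier G. word_length G Y g \<le> n}"

text \<open>
  The limits below are taken in the extended reals, where \<open>liminf\<close> and \<open>limsup\<close> always exist.
\<close>

definition exponential_growth :: "('a, 'b) monoid_scheme \<Rightarrow> bool" where
  "exponential_growth G \<longleftrightarrow>
     (\<exists>Y. finite_generating_set G Y \<and>
          liminf (\<lambda>n. ereal (root n (real (card (word_ball G Y n))))) > 1)"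

text \<open>The power \<open>G\<^sup>s\<close> is the set of extensional functions from \<open>{..<s}\<close> to the carrier.\<close>

definition exp_negligible ::
  "('a, 'b) monoid_scheme \<Rightarrow> 'a set \<Rightarrow> nat \<Rightarrow> (nat \<Rightarrow> 'a) set \<Rightarrow> bool" where
  "exp_negligible G Y s A \<longleftrightarrow>
     A \<subseteq> ({..<s} \<rightarrow>\<^sub>E carrier G) \<and>
     limsup (\<lambda>n. ereal (root n (real (card (A \<inter> ({..<s} \<rightarrow>\<^sub>E word_ball G Y n))) /
                                real (card (word_ball G Y n)) ^ s))) < 1"


section \<open>Commutators\<close>

definition commutator :: "('a, 'b) monoid_scheme \<Rightarrow> 'a \<Rightarrow> 'a \<Rightarrow> 'a" where
  "commutator G x y = inv\<^bsub>G\<^esub> x \<otimes>\<^bsub>G\<^esub> inv\<^bsub>G\<^esub> y \<otimes>\<^bsub>G\<^esub> x \<otimes>\<^bsub>G\<^esub> y"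

text \<open>\<open>iter_commutator G x r\<close> is the left-normed commutator of \<open>x 0, \<dots>, x r\<close>.\<close>

primrec iter_commutator :: "('a, 'b) monoid_scheme \<Rightarrow> (nat \<Rightarrow> 'a) \<Rightarrow> nat \<Rightarrow> 'a" where
  "iter_commutator G x 0 = x 0"
| "iter_commutator G x (Suc r) = commutator G (iter_commutator G x r) (x (Suc r))"

definition N_set :: "('a, 'b) monoid_scheme \<Rightarrow> nat \<Rightarrow> (nat \<Rightarrow> 'a) set" where
  "N_set G r = {x \<in> {..<r + 1} \<rightarrow>\<^sub>E carrier G. iter_commutator G x r = \<one>\<^bsub>G\<^esub>}"

end

theory Submission
  imports Defs "Jordan_Normal_Form.Spectral_Radius"
begin

text \<open>
  Write \<open>t\<close> for the stable letter. The exponent sum in \<open>t\<close> is a homomorphism from the group to the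
  integers, called the level \<open>lev\<close> below; its kernel consists of the conjugates of the elements
  \<open>a\<^sup>v\<close> by powers of \<open>t\<close> and is abelian. Suppose that \<open>T\<close> has an eigenvalue \<open>lam\<close> with
  \<open>norm lam > 1\<close>. A left eigenvector for \<open>lam\<close> gives a homomorphism to the group of complex affine maps
  with multipliers \<open>lam powi k\<close>, that is, a function \<open>psi\<close> with
  \<open>psi (x \<otimes> y) = psi x + lam powi lev x * psi y\<close>. Under \<open>psi\<close> the commutator \<open>[x\<^sub>0, x\<^sub>1]\<close> becomes, up
  to a unit, \<open>(lam powi lev x\<^sub>0 - 1) * psi x\<^sub>1 - (lam powi lev x\<^sub>1 - 1) * psi x\<^sub>0\<close>, and a further
  commutator with \<open>x\<^sub>i\<close> multiplies it by \<open>lam powi (- lev x\<^sub>i) - 1\<close>. As \<open>lam\<close> is not a root of unity, a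
  trivial iterated commutator forces one of the \<open>x\<^sub>i\<close> to have level zero, or it makes \<open>psi x\<^sub>1\<close> a
  function of \<open>x\<^sub>0\<close> and of the level of \<open>x\<^sub>1\<close> (\<open>N_set_covered\<close>). So it is enough that both the
  kernel of \<open>lev\<close> and every set \<open>{g. psi g = v (lev g)}\<close> have an exponentially small share of the ball
  of radius \<open>n\<close> (\<open>fibre_and_kernel_negligible\<close>).

  Let \<open>N = n div Q\<close> with \<open>Q\<close> large. If all prefixes of a word of length \<open>n\<close> have level between \<open>- N\<close>
  and \<open>N\<close>, then conjugation by a power of \<open>t\<close> turns its value into an integer vector of norm at most
  \<open>n\<close> times \<open>L ^ (2 * N)\<close> up to a constant, where \<open>L\<close> bounds the norm of \<open>T\<close>; there are few such
  vectors (\<open>near_negligible\<close>). A word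
  that reaches level \<open>N\<close>, say, comes close to each level in between, and a conjugate of a fixed kernel
  element \<open>b\<close> by \<open>t\<close> to the power of that level can be multiplied to its value by lengthening the word by a
  constant \<open>D\<close> (\<open>insert_shift\<close>). Cut the levels from zero to \<open>N\<close> into \<open>j\<close> blocks with \<open>R\<close> marked
  levels each and insert at one marked level of every block: this yields \<open>R ^ j\<close> products of
  conjugates, at a cost of \<open>D * j\<close> letters, and the value of \<open>psi\<close> tells the products apart like an
  expansion in base \<open>lam ^ s\<close> (\<open>digit_sum_inj\<close>).

  On a set \<open>{g. psi g = v (lev g)}\<close>, the modified element determines \<open>g\<close> and the choice of
  levels, so that \<open>R ^ j\<close> times the number of such \<open>g\<close> is at most the size of the ball of radius
  \<open>n + D * j\<close>. That ball is larger than the ball of radius \<open>n\<close> by a factor of at most the \<open>j\<close>-th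
  power of the size of the ball of radius \<open>D\<close>; choose \<open>R\<close> much larger than the latter
  (\<open>card_fibre_far\<close>). An element \<open>g\<close> of level zero whose word goes far is written as \<open>x \<otimes> inv y\<close> with \<open>x\<close> and \<open>y\<close> on
  the same far level. Insertion of the same product in \<open>x\<close> and in \<open>y\<close> does not change \<open>g\<close>, because the
  kernel is abelian. So each \<open>g\<close> comes from at least \<open>R ^ j\<close> pairs (\<open>card_kernel_far\<close>). The number
  of pairs exceeds the size of the ball only by a subexponential factor and a power
  of the size of the ball of radius \<open>D\<close>, since the growth function is nearly multiplicative
  (\<open>ball_growth_regular\<close>).

  Finally, exponential growth provides \<open>lam\<close>: if the spectral radius of \<open>T\<close> is at most one, then the
  powers of \<open>T\<close> grow polynomially, and so do the balls, by the same count of integer vectors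
  (\<open>subexponential_growth\<close>).
\<close>

section \<open>Balls in a finitely generated group\<close>

locale finitely_generated_group = group G for G (structure) +
  fixes Y
  assumes fin_gen: "finite_generating_set G Y"
begin

abbreviation ball :: "nat \<Rightarrow> 'a set" where
  "ball n \<equiv> word_ball G Y n"

lemma gens: "finite Y" "Y \<subseteq> carrier G" "generate G Y = carrier G"
  using fin_gen by (auto simp: finite_generating_set_def)

lemma gens_Pi: "(\<lambda>y. y) \<in> Y \<rightarrow> carrier G"
  using gens(2) by auto

lemmas eval_closed = eval_gword_closed[OF group_axioms gens_Pi]
  and eval_append = eval_gword_append[OF group_axioms gens_Pi]

lemma eval_inv:
  "w \<in> gwords Y \<Longrightarrow> eval_gword G (\<lambda>y. y) (gword_inv w) = inv (eval_gword G (\<lambda>y. y) w)"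
proof (induction w)
  case Nil
  then show ?case by (simp add: gword_inv_def)
next
  case (Cons l w)
  obtain y b where l: "l = (y, b)" by fastforce
  have y: "y \<in> Y" "y \<in> carrier G" and w: "w \<in> gwords Y" using Cons.prems gens(2) l by auto
  have "eval_gword G (\<lambda>y. y) (gword_inv w @ [(y, \<not> b)]) =
      inv (eval_gword G (\<lambda>y. y) w) \<otimes> (if b then inv y else y)"
    using w y by (subst eval_append) (auto simp: Cons.IH)
  then show ?case using y eval_closed[OF w] by (auto simp: gword_inv_def l inv_mult_group)
qed

lemma word_exists:
  assumes "g \<in> carrier G"
  shows "\<exists>w\<in>gwords Y. eval_gword G (\<lambda>y. y) w = g"
proof -
  have "g \<in> generate G Y" using assms gens(3) by simp
  then show ?thesis
  proof (induction rule: generate.induct)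
    case one
    then show ?case by (intro bexI[of _ "[]"]) auto
  next
    case (incl h)
    then show ?case using gens(2) by (intro bexI[of _ "[(h, True)]"]) auto
  next
    case (inv h)
    then show ?case using gens(2) by (intro bexI[of _ "[(h, False)]"]) auto
  next
    case (eng h1 h2)
    then obtain u v where "u \<in> gwords Y" "eval_gword G (\<lambda>y. y) u = h1"
      "v \<in> gwords Y" "eval_gword G (\<lambda>y. y) v = h2" by blast
    then show ?case by (intro bexI[of _ "u @ v"]) (auto simp: eval_append)
  qed
qed

lemma ball_iff:
  "g \<in> ball n \<longleftrightarrow> (\<exists>w\<in>gwords Y. length w \<le> n \<and> eval_gword G (\<lambda>y. y) w = g)"
proof
  let ?P = "\<lambda>k. \<exists>w\<in>gwords Y. length w = k \<and> eval_gword G (\<lambda>y. y) w = g"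
  {
    assume g: "g \<in> ball n"
    then have "\<exists>k. ?P k" using word_exists[of g] by (auto simp: word_ball_def)
    then have "?P (word_length G Y g)" unfolding word_length_def by (rule LeastI_ex)
    moreover have "word_length G Y g \<le> n" using g by (simp add: word_ball_def)
    ultimately show "\<exists>w\<in>gwords Y. length w \<le> n \<and> eval_gword G (\<lambda>y. y) w = g"
      by metis
  next
    assume "\<exists>w\<in>gwords Y. length w \<le> n \<and> eval_gword G (\<lambda>y. y) w = g"
    then obtain w where w: "w \<in> gwords Y" "length w \<le> n" "eval_gword G (\<lambda>y. y) w = g" by blast
    then have "word_length G Y g \<le> length w"
      unfolding word_length_def by (intro Least_le) auto
    then show "g \<in> ball n" using w eval_closed[of w] by (auto simp: word_ball_def)
  }
qed

lemma length_gword_inv: "length (gword_inv w) = length w"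
  by (simp add: gword_inv_def)

lemma ball_closed: "g \<in> ball n \<Longrightarrow> g \<in> carrier G"
  by (simp add: word_ball_def)

lemma ball_mono: "k \<le> n \<Longrightarrow> g \<in> ball k \<Longrightarrow> g \<in> ball n"
  by (auto simp: word_ball_def)

lemma one_in_ball: "\<one> \<in> ball n"
  unfolding ball_iff by (intro bexI[of _ "[]"]) auto

lemma ball_0: "ball 0 = {\<one>}"
  using one_in_ball by (auto simp: ball_iff)

lemma ball_mult: "x \<in> ball a \<Longrightarrow> y \<in> ball b \<Longrightarrow> x \<otimes> y \<in> ball (a + b)"
proof -
  assume "x \<in> ball a" "y \<in> ball b"
  then obtain u v where "u \<in> gwords Y" "length u \<le> a" "eval_gword G (\<lambda>y. y) u = x"
    "v \<in> gwords Y" "length v \<le> b" "eval_gword G (\<lambda>y. y) v = y" unfolding ball_iff by blast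
  then show ?thesis
    unfolding ball_iff by (intro bexI[of _ "u @ v"]) (auto simp: eval_append)
qed

lemma ball_inv: "x \<in> ball a \<Longrightarrow> inv x \<in> ball a"
proof -
  assume "x \<in> ball a"
  then obtain u where "u \<in> gwords Y" "length u \<le> a" "eval_gword G (\<lambda>y. y) u = x"
    unfolding ball_iff by blast
  then show ?thesis
    unfolding ball_iff by (intro bexI[of _ "gword_inv u"]) (auto simp: eval_inv length_gword_inv)
qed

lemma ball_split:
  assumes "g \<in> ball (a + b)"
  obtains x y where "x \<in> ball a" "y \<in> ball b" "g = x \<otimes> y"
proof -
  obtain w where w: "w \<in> gwords Y" "length w \<le> a + b" "eval_gword G (\<lambda>y. y) w = g"
    using assms unfolding ball_iff by blast
  have tk: "take a w \<in> gwords Y" "drop a w \<in> gwords Y"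
    using w(1) gwords_append[of "take a w" "drop a w" Y] by auto
  show ?thesis
  proof (rule that)
    show "eval_gword G (\<lambda>y. y) (take a w) \<in> ball a"
      using tk unfolding ball_iff by (intro bexI[of _ "take a w"]) auto
    show "eval_gword G (\<lambda>y. y) (drop a w) \<in> ball b"
      using tk w(2) unfolding ball_iff by (intro bexI[of _ "drop a w"]) auto
    show "g = eval_gword G (\<lambda>y. y) (take a w) \<otimes> eval_gword G (\<lambda>y. y) (drop a w)"
      using eval_append[OF tk] w(3) by simp
  qed
qed

lemma ball_SucE:
  assumes "g \<in> ball (Suc n)"
  obtains x y where "x \<in> ball n" "y \<in> ball 1" "g = x \<otimes> y"
  using ball_split[of g n 1] assms by auto

lemma finite_ball: "finite (ball n)"
proof (rule finite_subset)
  show "ball n \<subseteq> eval_gword G (\<lambda>y. y) ` {w. set w \<subseteq> Y \<times> UNIV \<and> length w \<le> n}"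
    by (auto simp: ball_iff gwords_def lists_eq_set)
  show "finite (eval_gword G (\<lambda>y. y) ` {w. set w \<subseteq> Y \<times> (UNIV :: bool set) \<and> length w \<le> n})"
    using gens(1) by (intro finite_imageI finite_lists_length_le) auto
qed

lemma in_some_ball: "g \<in> carrier G \<Longrightarrow> \<exists>n. g \<in> ball n"
  using word_exists[of g] unfolding ball_iff by blast

lemma finite_subset_ball:
  assumes "finite X" "X \<subseteq> carrier G"
  shows "\<exists>n. X \<subseteq> ball n"
  using assms
proof (induction X)
  case empty
  then show ?case by simp
next
  case (insert x X)
  then obtain a b where "X \<subseteq> ball a" "x \<in> ball b" using in_some_ball by blast
  then have "insert x X \<subseteq> ball (a + b)"
    using ball_mono[of a "a + b"] ball_mono[of b "a + b"] by auto
  then show ?case ..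
qed

lemma card_ball_pos: "card (ball n) \<ge> 1"
  using one_in_ball[of n] finite_ball[of n]
  by (metis One_nat_def Suc_leI card_gt_0_iff empty_iff)

lemma card_ball_mono: "a \<le> b \<Longrightarrow> card (ball a) \<le> card (ball b)"
  using ball_mono by (intro card_mono finite_ball) auto

lemma card_ball_add: "card (ball (a + b)) \<le> card (ball a) * card (ball b)"
proof -
  have "ball (a + b) \<subseteq> (\<lambda>(x, y). x \<otimes> y) ` (ball a \<times> ball b)"
    by (auto elim!: ball_split intro!: image_eqI)
  then have "card (ball (a + b)) \<le> card (ball a \<times> ball b)"
    by (intro surj_card_le) (auto simp: finite_ball)
  then show ?thesis by (simp add: card_cartesian_product)
qed

lemma card_ball_mult: "card (ball (a * k)) \<le> card (ball a) ^ k"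
proof (induction k)
  case 0
  then show ?case by (simp add: ball_0)
next
  case (Suc k)
  have "card (ball (a * Suc k)) \<le> card (ball a) * card (ball (a * k))"
    using card_ball_add[of a "a * k"] by simp
  then show ?case using Suc by (metis mult_le_mono2 order_trans power_Suc)
qed

end

section \<open>Exponentially small sequences\<close>

definition exp_small :: "(nat \<Rightarrow> real) \<Rightarrow> bool" where
  "exp_small f \<longleftrightarrow> (\<exists>C q. 0 \<le> C \<and> 0 < q \<and> q < 1 \<and> (\<forall>n. f n \<le> C * q ^ n))"

lemma exp_smallI: "0 \<le> C \<Longrightarrow> 0 < q \<Longrightarrow> q < 1 \<Longrightarrow> (\<And>n. f n \<le> C * q ^ n) \<Longrightarrow> exp_small f"
  unfolding exp_small_def by blast

lemma exp_small_mono: "exp_small g \<Longrightarrow> (\<And>n. f n \<le> g n) \<Longrightarrow> exp_small f"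
  unfolding exp_small_def by (meson order_trans)

lemma exp_small_add:
  assumes "exp_small f" "exp_small g"
  shows "exp_small (\<lambda>n. f n + g n)"
proof -
  obtain C q where f: "0 \<le> C" "0 < q" "q < 1" "\<And>n. f n \<le> C * q ^ n"
    using assms(1) unfolding exp_small_def by blast
  obtain D r where g: "0 \<le> D" "0 < r" "r < 1" "\<And>n. g n \<le> D * r ^ n"
    using assms(2) unfolding exp_small_def by blast
  show ?thesis
  proof (rule exp_smallI[of "C + D" "max q r"])
    fix n
    have "C * q ^ n \<le> C * max q r ^ n" "D * r ^ n \<le> D * max q r ^ n"
      using f g by (auto intro!: mult_left_mono power_mono)
    then show "f n + g n \<le> (C + D) * max q r ^ n"
      using f(4)[of n] g(4)[of n] by (simp add: distrib_right)
  qed (use f g in auto)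
qed

lemma exp_small_cmult:
  assumes "exp_small f" "a \<ge> 0"
  shows "exp_small (\<lambda>n. a * f n)"
proof -
  obtain C q where f: "0 \<le> C" "0 < q" "q < 1" "\<And>n. f n \<le> C * q ^ n"
    using assms(1) unfolding exp_small_def by blast
  have "a * f n \<le> (a * C) * q ^ n" for n
    using mult_left_mono[OF f(4)[of n] assms(2)] by (simp add: mult.assoc)
  then show ?thesis using f assms(2) by (intro exp_smallI[of "a * C" q]) auto
qed

text \<open>
  Bernoulli's inequality for \<open>1 / s\<close> bounds \<open>n * s ^ n\<close>.
\<close>

lemma linear_times_power_bounded:
  fixes s :: real
  assumes s: "0 < s" "s < 1"
  shows "real (a * n + d) * s ^ n \<le> real a / (1 / s - 1) + real d"
proof -
  let ?e = "1 / s - 1"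
  have e: "?e > 0" using s by simp
  have "1 + real n * ?e \<le> (1 + ?e) ^ n" using e by (intro Bernoulli_inequality) linarith
  also have "\<dots> = 1 / s ^ n" by (simp add: power_one_over)
  finally have "real n * ?e \<le> 1 / s ^ n" by simp
  then have "real n * ?e * s ^ n \<le> 1" using s by (simp add: pos_le_divide_eq)
  then have "real n * s ^ n \<le> 1 / ?e" using e by (simp add: pos_le_divide_eq ac_simps)
  then have "real a * (real n * s ^ n) \<le> real a * (1 / ?e)" by (intro mult_left_mono) auto
  moreover have "real d * s ^ n \<le> real d * 1" using s by (intro mult_left_mono power_le_one) auto
  ultimately show ?thesis by (simp add: algebra_simps)
qed

text \<open>
  Half of the decay, \<open>sqrt q ^ n\<close>, absorbs the linear factor.
\<close>

lemma exp_small_linear: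
  assumes "exp_small f"
  shows "exp_small (\<lambda>n. real (a * n + d) * f n)"
proof -
  obtain C q where f: "0 \<le> C" "0 < q" "q < 1" "\<And>n. f n \<le> C * q ^ n"
    using assms unfolding exp_small_def by blast
  let ?s = "sqrt q"
  have s: "0 < ?s" "?s < 1" using f by auto
  let ?B = "real a / (1 / ?s - 1) + real d"
  have q: "q ^ n = ?s ^ n * ?s ^ n" for n
    using f(2) by (simp flip: power_mult_distrib)
  show ?thesis
  proof (rule exp_smallI[of "C * ?B" ?s])
    fix n
    have "real (a * n + d) * f n \<le> real (a * n + d) * (C * q ^ n)"
      using f(4) by (intro mult_left_mono) auto
    also have "\<dots> = C * (real (a * n + d) * ?s ^ n) * ?s ^ n" by (simp add: q)
    also have "\<dots> \<le> C * ?B * ?s ^ n"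
      using linear_times_power_bounded[OF s] f s by (intro mult_right_mono mult_left_mono) auto
    finally show "real (a * n + d) * f n \<le> C * ?B * ?s ^ n" .
  next
    have "1 / ?s - 1 \<ge> 0" using s by simp
    then have "?B \<ge> 0" by (intro add_nonneg_nonneg divide_nonneg_nonneg) auto
    then show "0 \<le> C * ?B" using f(1) by (rule mult_nonneg_nonneg[rotated])
  qed (use s in auto)
qed

lemma exp_small_linear_pow:
  assumes "exp_small f"
  shows "exp_small (\<lambda>n. real (a * n + d) ^ k * f n)"
proof (induction k)
  case 0
  then show ?case using assms by simp
next
  case (Suc k)
  show ?case using exp_small_linear[OF Suc, of a d] by (simp add: mult.assoc)
qed

lemma exp_small_power: "0 < q \<Longrightarrow> q < 1 \<Longrightarrow> exp_small (\<lambda>n. q ^ n)"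
  by (rule exp_smallI[of 1 q]) auto

text \<open>
  Rounding in \<open>n div W\<close> costs a factor two; the lemma turns a gain of one half per \<open>W\<close> letters into
  genuine exponential decay in \<open>n\<close>.
\<close>

lemma half_power_div:
  assumes W: "W \<ge> 1"
  defines "q \<equiv> root W (1 / 2)"
  shows "0 < q" "q < 1" "(1 / 2) ^ (n div W) \<le> 2 * q ^ n"
proof -
  show q: "0 < q" "q < 1" unfolding q_def using W by auto
  have "n \<le> W * (n div W + 1)"
    using W mod_less_divisor[of W n] mult_div_mod_eq[of W n] unfolding distrib_left mult_1_right by linarith
  then have "q ^ (W * (n div W + 1)) \<le> q ^ n" using q by (intro power_decreasing) auto
  moreover have "q ^ W = 1 / 2" unfolding q_def using W by (intro real_root_pow_pos2) auto
  then have "q ^ (W * (n div W + 1)) = (1 / 2) ^ (n div W) / 2"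
    by (simp only: power_mult power_add power_one_right)
  ultimately show "(1 / 2) ^ (n div W) \<le> 2 * q ^ n" by simp
qed

lemma exp_negligible_if_exp_small:
  assumes sub: "A \<subseteq> {..<s} \<rightarrow>\<^sub>E carrier G"
    and small: "exp_small (\<lambda>n. real (card (A \<inter> ({..<s} \<rightarrow>\<^sub>E word_ball G Y n))) /
                                real (card (word_ball G Y n)) ^ s)"
  shows "exp_negligible G Y s A"
proof -
  let ?f = "\<lambda>n. real (card (A \<inter> ({..<s} \<rightarrow>\<^sub>E word_ball G Y n))) / real (card (word_ball G Y n)) ^ s"
  obtain C q where C: "0 \<le> C" "0 < q" "q < 1" "\<And>n. ?f n \<le> C * q ^ n"
    using small unfolding exp_small_def by blast
  have "(\<lambda>n. root n (C + 1) * q) \<longlonglongrightarrow> 1 * q"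
    using C by (intro tendsto_mult LIMSEQ_root_const tendsto_const) auto
  then have "(\<lambda>n. ereal (root n (C + 1) * q)) \<longlonglongrightarrow> ereal q" by simp
  then have "limsup (\<lambda>n. ereal (root n (C + 1) * q)) = ereal q"
    by (intro lim_imp_Limsup) auto
  moreover have "limsup (\<lambda>n. ereal (root n (?f n))) \<le> limsup (\<lambda>n. ereal (root n (C + 1) * q))"
  proof (rule Limsup_mono, rule eventually_mono[OF eventually_gt_at_top[of 0]])
    fix n :: nat assume n: "n > 0"
    have "?f n \<le> (C + 1) * q ^ n" using C(4)[of n] C(2) by (simp add: distrib_right add.commute add_increasing)
    then have "root n (?f n) \<le> root n ((C + 1) * q ^ n)" using n by simp
    also have "\<dots> = root n (C + 1) * q" using n C by (simp add: real_root_mult real_root_power_cancel)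
    finally show "ereal (root n (?f n)) \<le> ereal (root n (C + 1) * q)" by simp
  qed
  ultimately have "limsup (\<lambda>n. ereal (root n (?f n))) < 1" using C(3) by (simp add: order.strict_trans1)
  then show ?thesis using sub unfolding exp_negligible_def by simp
qed

section \<open>Regularity and independence of growth\<close>

context finitely_generated_group
begin

text \<open>
  This is Fekete's lemma. Let \<open>\<mu>\<close> be the infimum of the \<open>k\<close>-th roots of the ball sizes. Always
  \<open>\<mu> ^ n\<close> bounds the ball of radius \<open>n\<close> from below, and submultiplicativity, applied to a radius \<open>k\<close>
  at which the root is below \<open>\<mu> * q\<close>, gives an upper bound \<open>(\<mu> * q) ^ n\<close> up to a constant.
\<close>

lemma ball_growth_regular:
  assumes q: "q > 1"
  shows "\<exists>C\<ge>0. \<forall>a b. real (card (ball a)) * real (card (ball b)) \<le> C * q ^ (a + b) * real (card (ball (a + b)))"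
proof -
  let ?c = "\<lambda>n. real (card (ball n))"
  define \<mu> where "\<mu> = (INF k\<in>{1..}. root k (?c k))"
  have c1: "?c n \<ge> 1" for n using card_ball_pos[of n] by simp
  have bdd: "bdd_below ((\<lambda>k. root k (?c k)) ` {1..})"
    by (intro bdd_belowI2[of _ 0]) auto
  have mu1: "\<mu> \<ge> 1"
    unfolding \<mu>_def using c1 by (intro cINF_greatest) auto
  have lower: "\<mu> ^ n \<le> ?c n" for n
  proof (cases "n = 0")
    case True
    then show ?thesis using c1 by simp
  next
    case False
    then have "\<mu> \<le> root n (?c n)" unfolding \<mu>_def using bdd by (intro cINF_lower) auto
    then have "\<mu> ^ n \<le> root n (?c n) ^ n" using mu1 by (intro power_mono) auto
    then show ?thesis using False by (simp add: real_root_pow_pos2)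
  qed
  have "\<mu> < \<mu> * q" using mu1 q by simp
  then obtain k where k: "k \<ge> 1" "root k (?c k) < \<mu> * q"
    unfolding \<mu>_def using cINF_less_iff[OF _ bdd] by auto
  have ck: "?c k \<le> (\<mu> * q) ^ k"
  proof -
    have "root k (?c k) ^ k \<le> (\<mu> * q) ^ k" using k by (intro power_mono) auto
    then show ?thesis using k by (simp add: real_root_pow_pos2)
  qed
  have upper: "?c a \<le> ?c k * (\<mu> * q) ^ a" for a
  proof -
    have "card (ball a) \<le> card (ball (k * (a div k))) * card (ball (a mod k))"
      using card_ball_add[of "k * (a div k)" "a mod k"] by simp
    also have "\<dots> \<le> card (ball k) ^ (a div k) * card (ball k)"
      using k by (intro mult_le_mono card_ball_mult card_ball_mono) auto
    finally have "?c a \<le> ?c k ^ (a div k) * ?c k" by (simp only: of_nat_le_iff flip: of_nat_mult of_nat_power)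
    moreover have "?c k ^ (a div k) \<le> (\<mu> * q) ^ a"
    proof -
      have "?c k ^ (a div k) \<le> ((\<mu> * q) ^ k) ^ (a div k)" using ck by (intro power_mono) auto
      also have "\<dots> = (\<mu> * q) ^ (k * (a div k))" by (simp only: power_mult)
      also have "\<dots> \<le> (\<mu> * q) ^ a"
        using mu1 q by (intro power_increasing) (auto simp: mult_ge1_I)
      finally show ?thesis .
    qed
    then have "?c k ^ (a div k) * ?c k \<le> (\<mu> * q) ^ a * ?c k" by (intro mult_right_mono) auto
    ultimately show ?thesis by (simp add: mult.commute)
  qed
  have "?c a * ?c b \<le> (?c k)\<^sup>2 * q ^ (a + b) * ?c (a + b)" for a b
  proof -
    have "?c a * ?c b \<le> (?c k * (\<mu> * q) ^ a) * (?c k * (\<mu> * q) ^ b)"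
      using mu1 q by (intro mult_mono upper) auto
    also have "\<dots> = (?c k)\<^sup>2 * q ^ (a + b) * \<mu> ^ (a + b)"
      by (simp add: power_mult_distrib power_add power2_eq_square)
    also have "\<dots> \<le> (?c k)\<^sup>2 * q ^ (a + b) * ?c (a + b)"
      using lower q by (intro mult_left_mono) auto
    finally show ?thesis .
  qed
  then show ?thesis by (intro exI[of _ "(?c k)\<^sup>2"]) auto
qed

end

lemma exponential_growthE:
  assumes "exponential_growth G"
  obtains Y c where "finite_generating_set G Y" "c > 1"
    "eventually (\<lambda>n. c ^ n \<le> real (card (word_ball G Y n))) sequentially"
proof -
  obtain Y where Y: "finite_generating_set G Y"
    "1 < liminf (\<lambda>n. ereal (root n (real (card (word_ball G Y n)))))"
    using assms unfolding exponential_growth_def by blast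
  obtain c where c: "1 < ereal c" "ereal c < liminf (\<lambda>n. ereal (root n (real (card (word_ball G Y n)))))"
    using ereal_dense2[OF Y(2)] by blast
  have "eventually (\<lambda>n. ereal c < ereal (root n (real (card (word_ball G Y n))))) sequentially"
    using c(2) by (rule less_LiminfD)
  then have "eventually (\<lambda>n. c ^ n \<le> real (card (word_ball G Y n))) sequentially"
    using eventually_gt_at_top[of 0]
  proof eventually_elim
    case (elim n)
    then have "c ^ n \<le> root n (real (card (word_ball G Y n))) ^ n"
      using c(1) by (intro power_mono) auto
    then show ?case using elim by (simp add: real_root_pow_pos2)
  qed
  then show ?thesis using that Y(1) c(1) by simp
qed

text \<open>
  A ball for \<open>Y'\<close> of radius \<open>n\<close> lies in the ball for \<open>Y\<close> of radius \<open>L * n\<close>. One radius \<open>k\<close> with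
  fewer than \<open>d ^ k\<close> elements would, by submultiplicativity, spoil the lower bound at all large
  multiples of \<open>k\<close>; therefore the bound holds for every \<open>n\<close> and not only eventually.
\<close>

lemma (in finitely_generated_group) growth_transfer:
  assumes Y': "finite_generating_set G Y'" and c: "c > 1"
    and ev: "eventually (\<lambda>n. c ^ n \<le> real (card (word_ball G Y' n))) sequentially"
  shows "\<exists>d>1. \<forall>n. d ^ n \<le> real (card (ball n))"
proof -
  interpret Y': finitely_generated_group G Y' by unfold_locales fact
  obtain L0 where L0: "Y'.ball 1 \<subseteq> ball L0"
    using finite_subset_ball[OF Y'.finite_ball[of 1]] Y'.ball_closed by blast
  define L where "L = Suc L0"
  have L: "L \<ge> 1" "Y'.ball 1 \<subseteq> ball L" using L0 ball_mono[of L0 L] by (auto simp: L_def)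
  have sub: "Y'.ball n \<subseteq> ball (L * n)" for n
  proof (induction n)
    case 0
    then show ?case by (simp add: ball_0 Y'.ball_0)
  next
    case (Suc n)
    show ?case
    proof
      fix g assume "g \<in> Y'.ball (Suc n)"
      then obtain x y where xy: "x \<in> Y'.ball n" "y \<in> Y'.ball 1" "g = x \<otimes> y" by (rule Y'.ball_SucE)
      then have "x \<otimes> y \<in> ball (L * n + L)" using Suc L(2) by (intro ball_mult) auto
      then show "g \<in> ball (L * Suc n)" using xy by (simp add: add.commute)
    qed
  qed
  define d where "d = root L c"
  have d: "d > 1" "d ^ L = c" using L(1) c by (auto simp: d_def real_root_pow_pos2)
  obtain n0 where n0: "\<And>n. n \<ge> n0 \<Longrightarrow> c ^ n \<le> real (card (Y'.ball n))"
    using ev unfolding eventually_sequentially by blast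
  have "d ^ k \<le> real (card (ball k))" for k
  proof (cases "k = 0")
    case True
    then show ?thesis by (simp add: ball_0)
  next
    case False
    show ?thesis
    proof (rule ccontr)
      assume neg: "\<not> d ^ k \<le> real (card (ball k))"
      define n where "n = Suc n0"
      have "k * n \<ge> n0" using False by (cases k) (auto simp: n_def)
      then have "c ^ (k * n) \<le> real (card (Y'.ball (k * n)))" by (rule n0)
      also have "\<dots> \<le> real (card (ball (k * (L * n))))"
        using card_mono[OF finite_ball sub[of "k * n"]] by (simp add: ac_simps)
      also have "\<dots> \<le> real (card (ball k) ^ (L * n))" using card_ball_mult by (simp only: of_nat_le_iff)
      also have "\<dots> = real (card (ball k)) ^ (L * n)" by simp
      also have "\<dots> < (d ^ k) ^ (L * n)" using neg L(1) by (intro power_strict_mono) (auto simp: n_def)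
      also have "\<dots> = c ^ (k * n)" unfolding d(2)[symmetric] by (simp only: power_mult[symmetric] ac_simps)
      finally show False by simp
    qed
  qed
  then show ?thesis using d(1) by blast
qed

section \<open>Powers of integer matrices\<close>

lemma mat_vec_entry:
  assumes "A \<in> carrier_mat m m" "v \<in> carrier_vec m" "p < m"
  shows "(A *\<^sub>v v) $ p = (\<Sum>q<m. A $$ (p, q) * v $ q)"
  using assms by (simp add: scalar_prod_def atLeast0LessThan)

text \<open>
  The sum of the absolute values of all entries is a crude operator norm for the maximum norm on
  integer vectors; adding one makes powers of it monotone in the exponent.
\<close>

lemma mat_power_entry_bound:
  fixes T :: "int mat"
  assumes T: "T \<in> carrier_mat m m"
  shows "\<exists>L\<ge>1. \<forall>i H v. v \<in> carrier_vec m \<longrightarrow> (\<forall>p<m. \<bar>v $ p\<bar> \<le> int H) \<longrightarrow>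
    (\<forall>p<m. \<bar>((T ^\<^sub>m i) *\<^sub>v v) $ p\<bar> \<le> int (L ^ i * H))"
proof -
  define L where "L = 1 + (\<Sum>p<m. \<Sum>q<m. nat \<bar>T $$ (p, q)\<bar>)"
  have one: "\<bar>(T *\<^sub>v v) $ p\<bar> \<le> int (L * H)"
    if v: "v \<in> carrier_vec m" "\<forall>p<m. \<bar>v $ p\<bar> \<le> int H" and p: "p < m" for v H p
  proof -
    have "(T *\<^sub>v v) $ p = (\<Sum>q<m. T $$ (p, q) * v $ q)"
      using mat_vec_entry[OF T v(1) p] .
    also have "\<bar>\<dots>\<bar> \<le> (\<Sum>q<m. \<bar>T $$ (p, q)\<bar> * int H)"
      using v by (intro order_trans[OF sum_abs] sum_mono) (auto simp: abs_mult intro!: mult_left_mono)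
    also have "\<dots> = int ((\<Sum>q<m. nat \<bar>T $$ (p, q)\<bar>) * H)" by (simp add: sum_distrib_right)
    also have "(\<Sum>q<m. nat \<bar>T $$ (p, q)\<bar>) \<le> L"
      unfolding L_def using member_le_sum[of p "{..<m}" "\<lambda>p. \<Sum>q<m. nat \<bar>T $$ (p, q)\<bar>"] p by simp
    finally show ?thesis by (simp add: mult_right_mono)
  qed
  have "\<forall>p<m. \<bar>((T ^\<^sub>m i) *\<^sub>v v) $ p\<bar> \<le> int (L ^ i * H)"
    if "v \<in> carrier_vec m" "\<forall>p<m. \<bar>v $ p\<bar> \<le> int H" for i H v
    using that
  proof (induction i arbitrary: H v)
    case 0
    then show ?case using T by auto
  next
    case (Suc i)
    have "(T ^\<^sub>m Suc i) *\<^sub>v v = (T ^\<^sub>m i) *\<^sub>v (T *\<^sub>v v)"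
      using T Suc.prems by (simp add: assoc_mult_mat_vec[of _ m m _ m] pow_carrier_mat)
    moreover have "\<forall>p<m. \<bar>((T ^\<^sub>m i) *\<^sub>v (T *\<^sub>v v)) $ p\<bar> \<le> int (L ^ i * (L * H))"
      using Suc.prems one T by (intro Suc.IH) auto
    ultimately show ?case by (simp add: ac_simps)
  qed
  moreover have "L \<ge> 1" by (simp add: L_def)
  ultimately show ?thesis by blast
qed

text \<open>
  \<open>T\<close> and its transpose have the same spectrum. If the spectral radius exceeds one, an eigenvector of
  the transpose is a linear functional \<open>phi\<close> that \<open>T\<close> multiplies by \<open>lam\<close>; otherwise the Jordan form
  bounds the powers polynomially.
\<close>

lemma expanding_eigenvector_or_poly_powers:
  fixes T :: "int mat"
  assumes T: "T \<in> carrier_mat m m" and m: "m \<ge> 1"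
  shows "(\<exists>lam phi. norm lam > 1 \<and> (\<exists>i<m. phi i \<noteq> 0) \<and> (\<forall>u\<in>carrier_vec m.
      (\<Sum>i<m. phi i * complex_of_int ((T *\<^sub>v u) $ i)) = lam * (\<Sum>i<m. phi i * of_int (u $ i)))) \<or>
    (\<exists>a d. \<forall>i p q. p < m \<longrightarrow> q < m \<longrightarrow> \<bar>(T ^\<^sub>m i) $$ (p, q)\<bar> \<le> int (a * (i + 1) ^ d))"
proof -
  define C where "C = map_mat complex_of_int T"
  have C: "C \<in> carrier_mat m m" using T by (simp add: C_def)
  have Ct: "transpose_mat C \<in> carrier_mat m m" using C by simp
  have spec: "spectrum (transpose_mat C) = spectrum C"
    using spectrum_root_char_poly[OF C] spectrum_root_char_poly[OF Ct] char_poly_transpose_mat[OF C] by simp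
  show ?thesis
  proof (cases "spectral_radius C \<le> 1")
    case True
    from spectral_radius_jnf_norm_bound_le_1_upper_triangular[OF C True]
    obtain c1 c2 where c: "\<And>k. norm_bound (C ^\<^sub>m k) (c1 + c2 * of_nat k ^ (m - 1))" by blast
    define a where "a = nat \<lceil>\<bar>c1\<bar> + \<bar>c2\<bar>\<rceil>"
    have "\<bar>(T ^\<^sub>m i) $$ (p, q)\<bar> \<le> int (a * (i + 1) ^ (m - 1))" if pq: "p < m" "q < m" for i p q
    proof -
      have Ti: "T ^\<^sub>m i \<in> carrier_mat m m" using T by (rule pow_carrier_mat)
      have "C ^\<^sub>m i = map_mat complex_of_int (T ^\<^sub>m i)"
        unfolding C_def by (rule of_int_hom.mat_hom_pow[OF T, symmetric])
      then have entry: "(C ^\<^sub>m i) $$ (p, q) = complex_of_int ((T ^\<^sub>m i) $$ (p, q))"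
        using Ti pq by (metis carrier_matD index_map_mat(1))
      have "real_of_int \<bar>(T ^\<^sub>m i) $$ (p, q)\<bar> = norm ((C ^\<^sub>m i) $$ (p, q))" unfolding entry by simp
      also have "\<dots> \<le> c1 + c2 * of_nat i ^ (m - 1)"
        using c[of i] pow_carrier_mat[OF C, of i] pq by (metis norm_bound_def carrier_matD)
      also have "\<dots> \<le> \<bar>c1\<bar> * (real i + 1) ^ (m - 1) + \<bar>c2\<bar> * (real i + 1) ^ (m - 1)"
      proof (rule add_mono)
        have "\<bar>c1\<bar> * 1 \<le> \<bar>c1\<bar> * (real i + 1) ^ (m - 1)" by (intro mult_left_mono one_le_power) auto
        then show "c1 \<le> \<bar>c1\<bar> * (real i + 1) ^ (m - 1)" by linarith
        have "c2 * real i ^ (m - 1) \<le> \<bar>c2\<bar> * real i ^ (m - 1)" by (intro mult_right_mono) auto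
        also have "\<dots> \<le> \<bar>c2\<bar> * (real i + 1) ^ (m - 1)" by (intro mult_left_mono power_mono) auto
        finally show "c2 * of_nat i ^ (m - 1) \<le> \<bar>c2\<bar> * (real i + 1) ^ (m - 1)" .
      qed
      also have "\<dots> = (\<bar>c1\<bar> + \<bar>c2\<bar>) * (real i + 1) ^ (m - 1)" by (simp add: distrib_right)
      also have "\<dots> \<le> real a * (real i + 1) ^ (m - 1)"
        by (intro mult_right_mono) (auto simp: a_def intro: order_trans[OF le_of_int_ceiling])
      also have "\<dots> = real_of_int (int (a * (i + 1) ^ (m - 1)))" by (simp add: add.commute)
      finally show ?thesis by (simp only: of_int_le_iff)
    qed
    then show ?thesis by blast
  next
    case False
    then obtain lam where lam: "lam \<in> spectrum (transpose_mat C)" "norm lam > 1"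
      using spectral_radius_mem_max(1)[OF C] m spec by auto
    then obtain v where v: "v \<in> carrier_vec m" "v \<noteq> 0\<^sub>v m" "transpose_mat C *\<^sub>v v = lam \<cdot>\<^sub>v v"
      using Ct unfolding spectrum_def eigenvalue_def eigenvector_def by auto
    have "\<exists>i<m. v $ i \<noteq> 0"
    proof (rule ccontr)
      assume "\<not> ?thesis"
      then have "v = 0\<^sub>v m" using v(1) by (intro eq_vecI) auto
      then show False using v(2) by simp
    qed
    moreover have "(\<Sum>i<m. v $ i * complex_of_int ((T *\<^sub>v u) $ i)) = lam * (\<Sum>i<m. v $ i * of_int (u $ i))"
      if u: "u \<in> carrier_vec m" for u
    proof -
      have col: "(\<Sum>i<m. v $ i * complex_of_int (T $$ (i, j))) = lam * v $ j" if j: "j < m" for j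
      proof -
        have "(transpose_mat C *\<^sub>v v) $ j = (\<Sum>i<m. transpose_mat C $$ (j, i) * v $ i)"
          using mat_vec_entry[OF Ct v(1) j] .
        also have "\<dots> = (\<Sum>i<m. v $ i * complex_of_int (T $$ (i, j)))"
          using T j by (intro sum.cong) (auto simp: C_def mult.commute)
        finally show ?thesis using v j by simp
      qed
      have "(\<Sum>i<m. v $ i * complex_of_int ((T *\<^sub>v u) $ i))
          = (\<Sum>i<m. \<Sum>j<m. v $ i * complex_of_int (T $$ (i, j)) * of_int (u $ j))"
        using mat_vec_entry[OF T u] by (intro sum.cong) (auto simp: sum_distrib_left mult.assoc)
      also have "\<dots> = (\<Sum>j<m. \<Sum>i<m. v $ i * complex_of_int (T $$ (i, j)) * of_int (u $ j))"
        by (rule sum.swap)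
      also have "\<dots> = (\<Sum>j<m. lam * v $ j * of_int (u $ j))"
        using col by (intro sum.cong) (auto simp flip: sum_distrib_right)
      finally show ?thesis by (simp add: sum_distrib_left mult.assoc)
    qed
    ultimately show ?thesis using lam(2) by blast
  qed
qed

section \<open>Mapping tori of integer matrices\<close>

text \<open>
  An abstract view of the presented group: \<open>E v\<close> is \<open>a\<^sup>v\<close>, and \<open>lev\<close> is the exponent sum in \<open>t\<close>.
\<close>

locale mapping_torus = group G for G (structure) +
  fixes m :: nat and T :: "int mat" and t :: 'a and E :: "int vec \<Rightarrow> 'a" and lev :: "'a \<Rightarrow> int"
  assumes T_carrier: "T \<in> carrier_mat m m"
    and t_closed: "t \<in> carrier G"
    and E_closed: "v \<in> carrier_vec m \<Longrightarrow> E v \<in> carrier G"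
    and E_add: "u \<in> carrier_vec m \<Longrightarrow> v \<in> carrier_vec m \<Longrightarrow> E (u + v) = E u \<otimes> E v"
    and t_E: "v \<in> carrier_vec m \<Longrightarrow> t \<otimes> E v = E (T *\<^sub>v v) \<otimes> t"
    and generated: "generate G (insert t (E ` carrier_vec m)) = carrier G"
    and lev_mult: "x \<in> carrier G \<Longrightarrow> y \<in> carrier G \<Longrightarrow> lev (x \<otimes> y) = lev x + lev y"
    and lev_t: "lev t = 1"
    and lev_E: "v \<in> carrier_vec m \<Longrightarrow> lev (E v) = 0"
begin

lemmas closed [simp] = t_closed E_closed

lemma lev_one: "lev \<one> = 0"
  using lev_mult[of \<one> \<one>] by simp

lemma lev_inv: "x \<in> carrier G \<Longrightarrow> lev (inv x) = - lev x"
  using lev_mult[of x "inv x"] lev_one by simp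

lemma lev_t_pow: "lev (t [^] (k :: int)) = k"
proof -
  have nat: "lev (t [^] n) = int n" for n :: nat
    by (induction n) (auto simp: lev_one lev_mult lev_t)
  show ?thesis
    by (cases k rule: int_cases2) (simp_all add: int_pow_int int_pow_neg_int lev_inv nat)
qed

text \<open>
  \<open>v\<close> is a coordinate vector of \<open>g\<close> at depth \<open>N\<close>: formally, \<open>g = (T\<^sup>-\<^sup>N v, lev g)\<close> in the semidirect
  product. This avoids inverting \<open>T\<close>.
\<close>

definition rep :: "int \<Rightarrow> 'a \<Rightarrow> int vec \<Rightarrow> bool" where
  "rep N g v \<longleftrightarrow> v \<in> carrier_vec m \<and> t [^] N \<otimes> g = E v \<otimes> t [^] (N + lev g)"

lemma T_mult_closed [simp]: "v \<in> carrier_vec m \<Longrightarrow> T *\<^sub>v v \<in> carrier_vec m"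
  using T_carrier by simp

lemma T_pow_closed [simp]: "v \<in> carrier_vec m \<Longrightarrow> (T ^\<^sub>m j) *\<^sub>v v \<in> carrier_vec m"
  using T_carrier by (metis mult_mat_vec_carrier pow_carrier_mat)

lemma t_pow_add: "t [^] (i + j :: int) = t [^] i \<otimes> t [^] j"
  by (simp add: int_pow_mult)

lemma t_pow_cancel: "t [^] (- k :: int) \<otimes> t [^] k = \<one>" "t [^] k \<otimes> t [^] (- k :: int) = \<one>"
  using t_pow_add[of "- k" k] t_pow_add[of k "- k"] by simp_all

lemma rep_Suc:
  assumes "rep N g v" "g \<in> carrier G"
  shows "rep (N + 1) g (T *\<^sub>v v)"
proof -
  have v: "v \<in> carrier_vec m" and eq: "t [^] N \<otimes> g = E v \<otimes> t [^] (N + lev g)"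
    using assms(1) by (auto simp: rep_def)
  have t1: "t [^] (1 + k :: int) = t \<otimes> t [^] k" for k
    using t_pow_add[of 1 k] by simp
  have "t [^] (N + 1) \<otimes> g = t \<otimes> (t [^] N \<otimes> g)"
    using assms(2) t1[of N] by (simp add: add.commute m_assoc)
  also have "\<dots> = (t \<otimes> E v) \<otimes> t [^] (N + lev g)"
    using v by (simp add: eq m_assoc)
  also have "\<dots> = E (T *\<^sub>v v) \<otimes> t [^] (1 + (N + lev g))"
    using v by (simp only: t1 t_E) (simp add: m_assoc)
  finally show ?thesis using v by (simp add: rep_def ac_simps)
qed

lemma rep_add:
  assumes "rep N g v" "g \<in> carrier G"
  shows "rep (N + int j) g ((T ^\<^sub>m j) *\<^sub>v v)"
  using assms(1)
proof (induction j arbitrary: N v)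
  case 0
  then show ?case using T_carrier by (auto simp: rep_def)
next
  case (Suc j)
  have v: "v \<in> carrier_vec m" using Suc.prems by (simp add: rep_def)
  have "rep (N + 1 + int j) g ((T ^\<^sub>m j) *\<^sub>v (T *\<^sub>v v))"
    by (rule Suc.IH) (rule rep_Suc[OF Suc.prems assms(2)])
  moreover have "(T ^\<^sub>m j) *\<^sub>v (T *\<^sub>v v) = (T ^\<^sub>m Suc j) *\<^sub>v v"
    using T_carrier v by (simp add: assoc_mult_mat_vec[of _ m m _ m] pow_carrier_mat)
  ultimately show ?case by (simp add: ac_simps)
qed

text \<open>
  In the semidirect product the second factor is shifted by \<open>lev x\<close>, which amounts to reading it at
  depth \<open>N + lev x\<close>.
\<close>

lemma rep_mult:
  assumes "rep N x u" "rep (N + lev x) y v" "x \<in> carrier G" "y \<in> carrier G"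
  shows "rep N (x \<otimes> y) (u + v)"
proof -
  have uv: "u \<in> carrier_vec m" "v \<in> carrier_vec m" using assms by (auto simp: rep_def)
  have "t [^] N \<otimes> (x \<otimes> y) = t [^] N \<otimes> x \<otimes> y" using assms(3,4) by (simp add: m_assoc)
  also have "\<dots> = E u \<otimes> (t [^] (N + lev x) \<otimes> y)"
    using assms uv by (simp add: rep_def m_assoc)
  also have "\<dots> = E u \<otimes> (E v \<otimes> t [^] (N + lev x + lev y))"
    using assms(2) by (simp add: rep_def)
  also have "\<dots> = E (u + v) \<otimes> t [^] (N + lev (x \<otimes> y))"
    using uv assms(3,4) by (simp add: E_add m_assoc lev_mult add.assoc)
  finally show ?thesis using uv by (simp add: rep_def)
qed

lemma rep_unique:
  assumes "rep N g v" "rep N g' v" "lev g = lev g'" "g \<in> carrier G" "g' \<in> carrier G"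
  shows "g = g'"
proof -
  have "t [^] N \<otimes> g = t [^] N \<otimes> g'" using assms(1-3) by (simp add: rep_def)
  then show ?thesis using assms(4,5) by simp
qed

lemma E_zero: "E (0\<^sub>v m) = \<one>"
proof -
  have "E (0\<^sub>v m) \<otimes> E (0\<^sub>v m) = E (0\<^sub>v m)"
    using E_add[of "0\<^sub>v m" "0\<^sub>v m"] by simp
  then show ?thesis by simp
qed

lemma E_minus:
  assumes "v \<in> carrier_vec m"
  shows "inv (E v) = E (- v)"
proof (rule inv_equality)
  have "- v + v = 0\<^sub>v m" using assms by (simp add: uminus_l_inv_vec)
  then show "E (- v) \<otimes> E v = \<one>" using assms E_add[of "- v" v] E_zero by simp
qed (use assms in auto)

lemma rep_exists:
  assumes "g \<in> carrier G"
  shows "\<exists>K v. rep (int K) g v"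
proof -
  have rep0: "\<exists>K v. rep (int K) g v" if "g = E v \<otimes> t [^] k" "v \<in> carrier_vec m" for g v and k :: int
  proof -
    have "rep 0 g v" using that by (simp add: rep_def lev_mult lev_E lev_t_pow)
    then have "rep (int 0) g v" by simp
    then show ?thesis by blast
  qed
  have "g \<in> generate G (insert t (E ` carrier_vec m))" using assms generated by simp
  then show ?thesis
  proof (induction rule: generate.induct)
    case one
    show ?case by (rule rep0[of _ "0\<^sub>v m" 0]) (simp_all add: E_zero)
  next
    case (incl h)
    then consider "h = t" | v where "v \<in> carrier_vec m" "h = E v" by auto
    then show ?case
    proof cases
      case 1
      show ?thesis by (rule rep0[of _ "0\<^sub>v m" 1]) (simp_all add: E_zero 1)
    next
      case 2
      then show ?thesis by (intro rep0[of _ v 0]) simp_all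
    qed
  next
    case (inv h)
    then consider "h = t" | v where "v \<in> carrier_vec m" "h = E v" by auto
    then show ?case
    proof cases
      case 1
      show ?thesis by (rule rep0[of _ "0\<^sub>v m" "- 1"]) (simp_all add: E_zero 1 int_pow_neg)
    next
      case 2
      then show ?thesis by (intro rep0[of _ "- v" 0]) (simp_all add: E_minus)
    qed
  next
    case (eng x y)
    have xy: "x \<in> carrier G" "y \<in> carrier G" using eng.hyps by (auto simp: generated)
    obtain K u K' v where rx: "rep (int K) x u" and ry: "rep (int K') y v" using eng.IH by blast
    let ?N = "K + K' + nat \<bar>lev x\<bar>"
    have "\<exists>u. rep (int ?N) x u"
      using rep_add[OF rx xy(1), of "K' + nat \<bar>lev x\<bar>"] by (auto simp: add.assoc)
    moreover have "\<exists>v. rep (int ?N + lev x) y v"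
    proof -
      have "int ?N + lev x = int K' + int (nat (int K + \<bar>lev x\<bar> + lev x))" by simp
      then show ?thesis using rep_add[OF ry xy(2)] by metis
    qed
    ultimately show ?case using rep_mult xy by metis
  qed
qed

lemma rep_exists_common:
  assumes "finite X" "X \<subseteq> carrier G"
  shows "\<exists>K. \<forall>x\<in>X. \<exists>v. rep (int K) x v"
  using assms
proof (induction X)
  case empty
  then show ?case by simp
next
  case (insert x X)
  obtain K where K: "\<forall>x\<in>X. \<exists>v. rep (int K) x v" using insert by auto
  obtain L v where L: "rep (int L) x v" using rep_exists[of x] insert.prems by auto
  have "\<forall>y\<in>insert x X. \<exists>v. rep (int (K + L)) y v"
  proof
    fix y assume "y \<in> insert x X"
    then consider "y = x" | "y \<in> X" by auto
    then show "\<exists>v. rep (int (K + L)) y v"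
    proof cases
      case 1
      then show ?thesis using rep_add[OF L, of K] insert.prems by (auto simp: ac_simps)
    next
      case 2
      then obtain w where "rep (int K) y w" using K by blast
      then show ?thesis using rep_add[of "int K" y w L] 2 insert.prems by auto
    qed
  qed
  then show ?case by blast
qed

text \<open>
  At a common depth both products have coordinates \<open>u + v\<close>.
\<close>

lemma kernel_commute:
  assumes "x \<in> carrier G" "y \<in> carrier G" "lev x = 0" "lev y = 0"
  shows "x \<otimes> y = y \<otimes> x"
proof -
  obtain K where K: "\<forall>z\<in>{x, y}. \<exists>v. rep (int K) z v"
    using rep_exists_common[of "{x, y}"] assms by auto
  then obtain u v where uv: "rep (int K) x u" "rep (int K) y v" by auto
  then have c: "u \<in> carrier_vec m" "v \<in> carrier_vec m" by (auto simp: rep_def)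
  have "rep (int K) (x \<otimes> y) (u + v)" "rep (int K) (y \<otimes> x) (v + u)"
    using rep_mult[of "int K" x u y v] rep_mult[of "int K" y v x u] uv assms by auto
  moreover have "v + u = u + v" using c by (simp add: comm_add_vec)
  ultimately show ?thesis using assms by (intro rep_unique) (auto simp: lev_mult)
qed

end

section \<open>Words close to level zero\<close>

lemma card_bounded_vecs:
  "finite {v \<in> carrier_vec m. \<forall>p<m. \<bar>v $ p\<bar> \<le> int M}"
  "card {v \<in> carrier_vec m. \<forall>p<m. \<bar>v $ p\<bar> \<le> int M} \<le> (2 * M + 1) ^ m"
proof -
  let ?V = "{v \<in> carrier_vec m. \<forall>p<m. \<bar>v $ p\<bar> \<le> int M}"
  let ?F = "{..<m} \<rightarrow>\<^sub>E {- int M .. int M}"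
  have sub: "?V \<subseteq> vec m ` ?F"
  proof
    fix v assume v: "v \<in> ?V"
    then have "v = vec m (\<lambda>p\<in>{..<m}. v $ p)" by (intro eq_vecI) auto
    moreover have "(\<lambda>p\<in>{..<m}. v $ p) \<in> ?F" using v by (auto simp: abs_le_iff)
    ultimately show "v \<in> vec m ` ?F" by blast
  qed
  have fin: "finite ?F" by (intro finite_PiE) auto
  then show "finite ?V" using sub by (rule finite_surj)
  have "card ?V \<le> card ?F" using surj_card_le[OF fin sub] .
  also have "\<dots> = (2 * M + 1) ^ m"
  proof -
    have "nat (int M + 1 - - int M) = 2 * M + 1" by simp
    then show ?thesis by (simp add: card_PiE)
  qed
  finally show "card ?V \<le> (2 * M + 1) ^ m" .
qed

locale fg_mapping_torus =
  mapping_torus G m T t E lev + finitely_generated_group G Y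
  for G (structure) and m T t E lev Y
begin

lemma lev_bounded: "\<exists>J. \<forall>y\<in>ball 1. \<bar>lev y\<bar> \<le> int J"
proof -
  have "finite ((\<lambda>y. nat \<bar>lev y\<bar>) ` ball 1)" by (simp add: finite_ball)
  then obtain J where "\<forall>k\<in>(\<lambda>y. nat \<bar>lev y\<bar>) ` ball 1. k \<le> J"
    using finite_nat_set_iff_bounded_le by blast
  then show ?thesis by (intro exI[of _ J]) auto
qed

lemma lev_ball:
  assumes J: "\<forall>y\<in>ball 1. \<bar>lev y\<bar> \<le> int J"
  shows "x \<in> ball n \<Longrightarrow> \<bar>lev x\<bar> \<le> int (n * J)"
proof (induction n arbitrary: x)
  case 0
  then show ?case by (simp add: ball_0 lev_one)
next
  case (Suc n)
  obtain x' y where xy: "x' \<in> ball n" "y \<in> ball 1" "x = x' \<otimes> y" using ball_SucE[OF Suc.prems] .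
  have "lev x = lev x' + lev y" using xy by (simp add: lev_mult ball_closed)
  moreover have "\<bar>lev x'\<bar> \<le> int (n * J)" "\<bar>lev y\<bar> \<le> int J" using Suc.IH xy J by auto
  ultimately show ?case by simp
qed

text \<open>
  The values of words of length at most \<open>n\<close> some prefix of which has its level in \<open>L\<close>.
\<close>

definition far :: "int set \<Rightarrow> nat \<Rightarrow> 'a set" where
  "far L n = {g. \<exists>n1\<le>n. \<exists>x\<in>ball n1. \<exists>y\<in>ball (n - n1). g = x \<otimes> y \<and> lev x \<in> L}"

definition near :: "nat \<Rightarrow> nat \<Rightarrow> nat \<Rightarrow> 'a set" where
  "near N K M = {g \<in> carrier G. \<bar>lev g\<bar> < int N \<and>
     (\<exists>v. rep (int (N + K)) g v \<and> (\<forall>p<m. \<bar>v $ p\<bar> \<le> int M))}"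

lemma far_ball: "far L n \<subseteq> ball n"
proof
  fix g assume "g \<in> far L n"
  then obtain n1 x y where "n1 \<le> n" "x \<in> ball n1" "y \<in> ball (n - n1)" "g = x \<otimes> y"
    unfolding far_def by blast
  then show "g \<in> ball n" using ball_mult[of x n1 y "n - n1"] by simp
qed

text \<open>
  Follow a word letter by letter until a prefix leaves the levels between \<open>- N\<close> and \<open>N\<close>. Before that,
  a letter \<open>y\<close> read at level \<open>l\<close> adds \<open>T\<close> to the power \<open>N + l\<close>, applied to the coordinates of \<open>y\<close>
  at depth \<open>K\<close>, and this exponent lies between \<open>0\<close> and \<open>2 * N\<close>.
\<close>

lemma near_or_far:
  assumes K: "\<forall>y\<in>ball 1. rep (int K) y (w y)"
    and h: "\<forall>y\<in>ball 1. \<forall>i\<le>2 * N. \<forall>p<m. \<bar>((T ^\<^sub>m i) *\<^sub>v w y) $ p\<bar> \<le> int h"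
  shows "g \<in> ball n \<Longrightarrow> g \<in> far {k. int N \<le> \<bar>k\<bar>} n \<union> near N K (n * h)"
proof (induction n arbitrary: g)
  case 0
  then have g: "g = \<one>" by (simp add: ball_0)
  show ?case
  proof (cases "N = 0")
    case True
    then have "\<one> \<in> far {k. int N \<le> \<bar>k\<bar>} 0"
      unfolding far_def using ball_0 by (auto intro!: bexI[of _ \<one>])
    then show ?thesis using g by simp
  next
    case False
    have "rep (int (N + K)) \<one> (0\<^sub>v m)" by (simp add: rep_def lev_one E_zero)
    then have "\<one> \<in> near N K (0 * h)" using False by (auto simp: near_def lev_one)
    then show ?thesis using g by simp
  qed
next
  case (Suc n)
  obtain x y where xy: "x \<in> ball n" "y \<in> ball 1" "g = x \<otimes> y" using ball_SucE[OF Suc.prems] .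
  then have c: "x \<in> carrier G" "y \<in> carrier G" by (auto intro: ball_closed)
  from Suc.IH[OF xy(1)] show ?case
  proof
    assume "x \<in> far {k. int N \<le> \<bar>k\<bar>} n"
    then obtain n1 x1 x2 where x: "n1 \<le> n" "x1 \<in> ball n1" "x2 \<in> ball (n - n1)" "x = x1 \<otimes> x2"
      "int N \<le> \<bar>lev x1\<bar>" unfolding far_def by blast
    have "x2 \<otimes> y \<in> ball (Suc n - n1)" using ball_mult[OF x(3) xy(2)] x(1) by (simp add: Suc_diff_le)
    moreover have "g = x1 \<otimes> (x2 \<otimes> y)" using xy x by (simp add: m_assoc ball_closed)
    ultimately have "g \<in> far {k. int N \<le> \<bar>k\<bar>} (Suc n)"
      unfolding far_def using x by (auto intro!: exI[of _ n1])
    then show ?thesis by simp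
  next
    assume "x \<in> near N K (n * h)"
    then obtain v where v: "\<bar>lev x\<bar> < int N" "rep (int (N + K)) x v" "\<forall>p<m. \<bar>v $ p\<bar> \<le> int (n * h)"
      by (auto simp: near_def)
    show ?thesis
    proof (cases "int N \<le> \<bar>lev g\<bar>")
      case True
      have "g \<in> far {k. int N \<le> \<bar>k\<bar>} (Suc n)"
        unfolding far_def mem_Collect_eq using Suc.prems True one_in_ball ball_closed
        by (intro exI[of _ "Suc n"] conjI bexI[of _ g] bexI[of _ \<one>]) auto
      then show ?thesis by simp
    next
      case False
      let ?i = "nat (int N + lev x)"
      let ?v' = "(T ^\<^sub>m ?i) *\<^sub>v w y"
      have "int K + int ?i = int (N + K) + lev x" using v(1) by simp
      then have r: "rep (int (N + K) + lev x) y ?v'"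
        using rep_add[of "int K" y "w y" ?i] K xy(2) c by metis
      have "rep (int (N + K)) g (v + ?v')"
        using rep_mult[OF v(2) r] c xy(3) by simp
      moreover have "\<bar>(v + ?v') $ p\<bar> \<le> int (Suc n * h)" if p: "p < m" for p
      proof -
        have "?v' \<in> carrier_vec m" using r by (simp add: rep_def)
        then have "(v + ?v') $ p = v $ p + ?v' $ p"
          using p by (metis index_add_vec(1) carrier_vecD)
        moreover have "\<bar>?v' $ p\<bar> \<le> int h" using h xy(2) p v(1) by simp
        moreover have "\<bar>v $ p\<bar> \<le> int (n * h)" using v(3) p by simp
        ultimately show ?thesis by simp
      qed
      moreover have "g \<in> carrier G" using c xy by simp
      ultimately have "g \<in> near N K (Suc n * h)" using False by (auto simp: near_def)
      then show ?thesis by simp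
    qed
  qed
qed

lemma card_near:
  "finite (near N K M)" "card (near N K M) \<le> (2 * N + 1) * (2 * M + 1) ^ m"
proof -
  \<comment> \<open>The level and one chosen coordinate vector determine the element.\<close>
  define V where "V = {v \<in> carrier_vec m. \<forall>p<m. \<bar>v $ p\<bar> \<le> int M}"
  let ?X = "{- int N .. int N} \<times> V"
  define f where "f g = (lev g, SOME v. rep (int (N + K)) g v \<and> (\<forall>p<m. \<bar>v $ p\<bar> \<le> int M))" for g
  have f: "rep (int (N + K)) g (snd (f g)) \<and> snd (f g) \<in> V" if g: "g \<in> near N K M" for g
  proof -
    have "\<exists>v. rep (int (N + K)) g v \<and> (\<forall>p<m. \<bar>v $ p\<bar> \<le> int M)" using g by (auto simp: near_def)
    from someI_ex[OF this] show ?thesis by (auto simp: f_def V_def rep_def)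
  qed
  have inj: "inj_on f (near N K M)"
  proof (rule inj_onI)
    fix x y assume xy: "x \<in> near N K M" "y \<in> near N K M" "f x = f y"
    then have "lev x = lev y" by (simp add: f_def)
    then show "x = y" using f[OF xy(1)] f[OF xy(2)] xy by (auto simp: near_def intro: rep_unique)
  qed
  have sub: "f ` near N K M \<subseteq> ?X"
  proof
    fix z assume "z \<in> f ` near N K M"
    then obtain g where g: "g \<in> near N K M" "z = f g" by blast
    have "fst z \<in> {- int N .. int N}" using g by (auto simp: f_def near_def)
    then show "z \<in> ?X" using f[OF g(1)] g(2) by (simp add: mem_Times_iff)
  qed
  have fin: "finite ?X" unfolding V_def using card_bounded_vecs(1) by auto
  show "finite (near N K M)" using inj_on_finite[OF inj sub fin] .
  have "card (near N K M) \<le> card ?X" using card_inj_on_le[OF inj sub fin] .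
  also have "\<dots> = (2 * N + 1) * card V"
  proof -
    have "card {- int N .. int N} = 2 * N + 1" by simp
    then show ?thesis by (simp only: card_cartesian_product)
  qed
  also have "\<dots> \<le> (2 * N + 1) * (2 * M + 1) ^ m"
    unfolding V_def using card_bounded_vecs(2) by (intro mult_le_mono2)
  finally show "card (near N K M) \<le> (2 * N + 1) * (2 * M + 1) ^ m" .
qed

lemma letter_reps: "\<exists>K w H. \<forall>y\<in>ball 1. rep (int K) y (w y) \<and> (\<forall>p<m. \<bar>w y $ p\<bar> \<le> int H)"
proof -
  obtain K where K: "\<forall>y\<in>ball 1. \<exists>v. rep (int K) y v"
    using rep_exists_common[of "ball 1"] finite_ball[of 1] ball_closed by blast
  then obtain w where w: "\<forall>y\<in>ball 1. rep (int K) y (w y)" using bchoice by metis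
  define H where "H = (\<Sum>y\<in>ball 1. \<Sum>p<m. nat \<bar>w y $ p\<bar>)"
  have "\<bar>w y $ p\<bar> \<le> int H" if "y \<in> ball 1" "p < m" for y p
  proof -
    have "nat \<bar>w y $ p\<bar> \<le> (\<Sum>p<m. nat \<bar>w y $ p\<bar>)" using that by (intro member_le_sum) auto
    also have "\<dots> \<le> H" unfolding H_def using that finite_ball by (intro member_le_sum) auto
    finally show ?thesis by simp
  qed
  then show ?thesis using w by blast
qed

text \<open>
  The number of coordinate vectors is, up to a polynomial factor, a power of \<open>L ^ (2 * m)\<close> with
  exponent \<open>n div Q\<close>. Choosing \<open>Q\<close> with \<open>L ^ (2 * m) \<le> sqrt c ^ Q\<close> keeps it below \<open>sqrt c ^ n\<close>,
  while the ball has at least \<open>c ^ n\<close> elements.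
\<close>

lemma near_negligible:
  assumes c: "c > 1" "\<And>n. c ^ n \<le> real (card (ball n))"
  shows "\<exists>Q K M. Q \<ge> 1 \<and>
    (\<forall>n. ball n \<subseteq> far {k. int (n div Q) \<le> \<bar>k\<bar>} n \<union> near (n div Q) K (M n)) \<and>
    exp_small (\<lambda>n. real (card (near (n div Q) K (M n))) / real (card (ball n)))"
proof -
  obtain K w H where w: "\<forall>y\<in>ball 1. rep (int K) y (w y) \<and> (\<forall>p<m. \<bar>w y $ p\<bar> \<le> int H)"
    using letter_reps by blast
  obtain L where L: "L \<ge> 1" "\<And>i H v. v \<in> carrier_vec m \<Longrightarrow> \<forall>p<m. \<bar>v $ p\<bar> \<le> int H \<Longrightarrow>
    \<forall>p<m. \<bar>((T ^\<^sub>m i) *\<^sub>v v) $ p\<bar> \<le> int (L ^ i * H)"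
    using mat_power_entry_bound[OF T_carrier] by blast
  define e where "e = sqrt c"
  have e: "e > 1" "e * e = c" using c by (auto simp: e_def)
  obtain Q' where Q': "real (L ^ (2 * m)) < e ^ Q'" using real_arch_pow[OF e(1)] by blast
  define Q where "Q = Suc Q'"
  have "e ^ Q' \<le> e ^ Q" using e(1) unfolding Q_def by (intro power_increasing) auto
  then have Q: "Q \<ge> 1" "real (L ^ (2 * m)) \<le> e ^ Q" using Q' by (simp_all only: Q_def)
  define M where "M n = n * (L ^ (2 * (n div Q)) * H)" for n
  have cover: "ball n \<subseteq> far {k. int (n div Q) \<le> \<bar>k\<bar>} n \<union> near (n div Q) K (M n)" for n
  proof -
    let ?h = "L ^ (2 * (n div Q)) * H"
    have "\<bar>((T ^\<^sub>m i) *\<^sub>v w y) $ p\<bar> \<le> int ?h"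
      if "y \<in> ball 1" "i \<le> 2 * (n div Q)" "p < m" for y i p
    proof -
      have "\<bar>((T ^\<^sub>m i) *\<^sub>v w y) $ p\<bar> \<le> int (L ^ i * H)"
        using L(2)[of "w y" H i] w that by (auto simp: rep_def)
      also have "L ^ i * H \<le> ?h" using L(1) that by (intro mult_le_mono1 power_increasing) auto
      finally show ?thesis by simp
    qed
    then show ?thesis using near_or_far[of K w "n div Q" ?h _ n] w by (auto simp: M_def)
  qed
  have bound: "real (card (near (n div Q) K (M n))) / real (card (ball n))
      \<le> real (2 * n + 1) ^ 1 * (real (2 * H * n + 1) ^ m * (1 / e) ^ n)" for n
  proof -
    let ?N = "n div Q"
    have NL: "real (L ^ (2 * m)) ^ ?N \<le> e ^ n"
    proof -
      have "real (L ^ (2 * m)) ^ ?N \<le> (e ^ Q) ^ ?N" using Q by (intro power_mono) auto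
      also have "\<dots> \<le> e ^ n" using e by (simp flip: power_mult)
      finally show ?thesis .
    qed
    have "2 * M n + 1 \<le> (2 * H * n + 1) * L ^ (2 * ?N)"
      unfolding M_def using L(1) by (simp add: algebra_simps)
    then have "(2 * M n + 1) ^ m \<le> ((2 * H * n + 1) * L ^ (2 * ?N)) ^ m" by (intro power_mono) auto
    then have "(2 * ?N + 1) * (2 * M n + 1) ^ m \<le> (2 * n + 1) * ((2 * H * n + 1) * L ^ (2 * ?N)) ^ m"
      by (intro mult_le_mono) auto
    then have "card (near ?N K (M n)) \<le> (2 * n + 1) * ((2 * H * n + 1) * L ^ (2 * ?N)) ^ m"
      using card_near(2)[of ?N K "M n"] by linarith
    also have "\<dots> = (2 * n + 1) * ((2 * H * n + 1) ^ m * (L ^ (2 * m)) ^ ?N)"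
      by (simp only: power_mult_distrib power_mult[symmetric] ac_simps)
    finally have "real (card (near ?N K (M n)))
        \<le> real ((2 * n + 1) * ((2 * H * n + 1) ^ m * (L ^ (2 * m)) ^ ?N))"
      by (simp only: of_nat_le_iff)
    also have "\<dots> = real (2 * n + 1) * (real (2 * H * n + 1) ^ m * real (L ^ (2 * m)) ^ ?N)"
      by (simp only: of_nat_mult of_nat_power)
    also have "\<dots> \<le> real (2 * n + 1) * (real (2 * H * n + 1) ^ m * e ^ n)"
      using NL by (intro mult_left_mono) auto
    finally have "real (card (near ?N K (M n))) / real (card (ball n))
        \<le> real (2 * n + 1) * (real (2 * H * n + 1) ^ m * e ^ n) / c ^ n"
      using c e by (intro frac_le) auto
    also have "\<dots> = real (2 * n + 1) ^ 1 * (real (2 * H * n + 1) ^ m * (1 / e) ^ n)"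
      using e by (simp add: power_mult_distrib power_one_over field_simps flip: e(2))
    finally show ?thesis .
  qed
  have "exp_small (\<lambda>n. real (2 * n + 1) ^ 1 * (real (2 * H * n + 1) ^ m * (1 / e) ^ n))"
    using e by (intro exp_small_linear_pow exp_small_power) auto
  then have "exp_small (\<lambda>n. real (card (near (n div Q) K (M n))) / real (card (ball n)))"
    using bound by (rule exp_small_mono)
  then show ?thesis using cover Q(1) by blast
qed

text \<open>
  Words of length \<open>n\<close> never leave the levels up to \<open>n * J\<close>, so all of the ball is near for
  \<open>N = n * J + 1\<close>, and the coordinates at that depth are polynomially bounded in \<open>n\<close>.
\<close>

lemma subexponential_growth:
  assumes poly: "\<And>i p q. p < m \<Longrightarrow> q < m \<Longrightarrow> \<bar>(T ^\<^sub>m i) $$ (p, q)\<bar> \<le> int (a * (i + 1) ^ d)"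
    and c: "c > 1"
  shows "exp_small (\<lambda>n. real (card (ball n)) * (1 / c) ^ n)"
proof -
  obtain K w H where w: "\<forall>y\<in>ball 1. rep (int K) y (w y) \<and> (\<forall>p<m. \<bar>w y $ p\<bar> \<le> int H)"
    using letter_reps by blast
  obtain J where J: "\<forall>y\<in>ball 1. \<bar>lev y\<bar> \<le> int J" using lev_bounded by blast
  define A where "A = m * a * H"
  have bound: "card (ball n) \<le> (2 * J * n + 3) ^ (1 + d * m) * (2 * A * n + 1) ^ m" for n
  proof -
    let ?N = "n * J + 1"
    let ?h = "A * (2 * ?N + 1) ^ d"
    have "\<bar>((T ^\<^sub>m i) *\<^sub>v w y) $ p\<bar> \<le> int ?h"
      if y: "y \<in> ball 1" and i: "i \<le> 2 * ?N" and p: "p < m" for y i p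
    proof -
      have wy: "w y \<in> carrier_vec m" using w y by (auto simp: rep_def)
      have Ti: "T ^\<^sub>m i \<in> carrier_mat m m" using T_carrier by (rule pow_carrier_mat)
      have "((T ^\<^sub>m i) *\<^sub>v w y) $ p = (\<Sum>q<m. (T ^\<^sub>m i) $$ (p, q) * w y $ q)"
        using mat_vec_entry[OF Ti wy p] .
      also have "\<bar>\<dots>\<bar> \<le> (\<Sum>q<m. int (a * (i + 1) ^ d) * int H)"
        using w y poly[OF p] by (intro order_trans[OF sum_abs] sum_mono)
          (auto simp: abs_mult simp del: of_nat_mult of_nat_power intro!: mult_mono)
      also have "\<dots> = int (A * (i + 1) ^ d)" by (simp add: A_def)
      also have "A * (i + 1) ^ d \<le> ?h" using i by (intro mult_le_mono2 power_mono) auto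
      finally show ?thesis by simp
    qed
    then have cover: "ball n \<subseteq> far {k. int ?N \<le> \<bar>k\<bar>} n \<union> near ?N K (n * ?h)"
      using near_or_far[of K w ?N ?h _ n] w by blast
    have "far {k. int ?N \<le> \<bar>k\<bar>} n = {}"
    proof -
      have False if x: "x \<in> ball n1" "n1 \<le> n" "int ?N \<le> \<bar>lev x\<bar>" for x n1
      proof -
        have "\<bar>lev x\<bar> \<le> int (n1 * J)" using lev_ball[OF J x(1)] .
        also have "\<dots> \<le> int (n * J)" using x(2) by (simp only: of_nat_le_iff) (rule mult_le_mono1)
        finally show False using x(3) by simp
      qed
      then show ?thesis unfolding far_def by blast
    qed
    then have "card (ball n) \<le> card (near ?N K (n * ?h))"
      using cover card_near(1) by (intro card_mono) auto
    also have "\<dots> \<le> (2 * ?N + 1) * (2 * (n * ?h) + 1) ^ m" by (rule card_near(2))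
    also have "\<dots> \<le> (2 * ?N + 1) * ((2 * A * n + 1) * (2 * ?N + 1) ^ d) ^ m"
      by (intro mult_le_mono2 power_mono) (auto simp: algebra_simps)
    also have "\<dots> = (2 * ?N + 1) ^ (1 + d * m) * (2 * A * n + 1) ^ m"
      by (simp only: power_mult_distrib power_mult[symmetric] power_add power_one_right ac_simps)
    also have "2 * ?N + 1 = 2 * J * n + 3" by simp
    finally show ?thesis .
  qed
  have "exp_small (\<lambda>n. real (2 * J * n + 3) ^ (1 + d * m) * (real (2 * A * n + 1) ^ m * (1 / c) ^ n))"
    using c by (intro exp_small_linear_pow exp_small_power) auto
  moreover have "real (card (ball n)) * (1 / c) ^ n
      \<le> real (2 * J * n + 3) ^ (1 + d * m) * (real (2 * A * n + 1) ^ m * (1 / c) ^ n)" for n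
  proof -
    have "real (card (ball n)) \<le> real (2 * J * n + 3) ^ (1 + d * m) * real (2 * A * n + 1) ^ m"
      using bound[of n] by (simp only: of_nat_le_iff flip: of_nat_mult of_nat_power)
    then have "real (card (ball n)) * (1 / c) ^ n
        \<le> real (2 * J * n + 3) ^ (1 + d * m) * real (2 * A * n + 1) ^ m * (1 / c) ^ n"
      using c by (intro mult_right_mono) auto
    then show ?thesis by (simp only: mult.assoc)
  qed
  ultimately show ?thesis by (rule exp_small_mono)
qed

end

section \<open>Inserting conjugates into a word\<close>

context fg_mapping_torus
begin

definition shift :: "'a \<Rightarrow> int \<Rightarrow> 'a" where
  "shift b l = t [^] l \<otimes> b \<otimes> t [^] (- l)"

primrec shifts :: "'a \<Rightarrow> int list \<Rightarrow> 'a" where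
  "shifts b [] = \<one>"
| "shifts b (l # ls) = shift b l \<otimes> shifts b ls"

lemma shift_closed [simp]: "b \<in> carrier G \<Longrightarrow> shift b l \<in> carrier G"
  by (simp add: shift_def)

lemma shifts_closed [simp]: "b \<in> carrier G \<Longrightarrow> shifts b ls \<in> carrier G"
  by (induction ls) auto

lemma lev_shift: "b \<in> carrier G \<Longrightarrow> lev b = 0 \<Longrightarrow> lev (shift b l) = 0"
  by (simp add: shift_def lev_mult lev_t_pow)

lemma lev_shifts: "b \<in> carrier G \<Longrightarrow> lev b = 0 \<Longrightarrow> lev (shifts b ls) = 0"
  by (induction ls) (auto simp: lev_mult lev_shift lev_one)

text \<open>
  \<open>t [^] l\<close> and \<open>x \<otimes> t [^] (l - lev x)\<close> differ by an element \<open>u\<close> of the kernel, and \<open>u\<close> commutes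
  with \<open>b\<close>. Hence only the level of \<open>x\<close> matters when a conjugate of \<open>b\<close> is moved past \<open>x\<close>.
\<close>

lemma shift_through:
  assumes b: "b \<in> carrier G" "lev b = 0" and x: "x \<in> carrier G"
  shows "shift b l \<otimes> x = x \<otimes> shift b (l - lev x)"
proof -
  let ?i = "l - lev x"
  define u where "u = t [^] (- ?i) \<otimes> inv x \<otimes> t [^] l"
  have u: "u \<in> carrier G" "lev u = 0" using x by (auto simp: u_def lev_mult lev_inv lev_t_pow)
  have tu: "t [^] l = x \<otimes> t [^] ?i \<otimes> u"
  proof -
    have "x \<otimes> t [^] ?i \<otimes> u = x \<otimes> (t [^] ?i \<otimes> t [^] (- ?i)) \<otimes> inv x \<otimes> t [^] l"
      unfolding u_def using x by (simp add: m_assoc del: minus_diff_eq)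
    also have "\<dots> = t [^] l" using x t_pow_cancel(2)[of ?i] by simp
    finally show ?thesis by simp
  qed
  have itu: "t [^] (- l) = inv u \<otimes> t [^] (- ?i) \<otimes> inv x"
  proof -
    have "t [^] (- l) = inv (x \<otimes> t [^] ?i \<otimes> u)" by (simp add: int_pow_neg flip: tu)
    also have "\<dots> = inv u \<otimes> t [^] (- ?i) \<otimes> inv x"
      using x u by (simp add: inv_mult_group m_assoc int_pow_neg del: minus_diff_eq)
    finally show ?thesis .
  qed
  have "u \<otimes> b \<otimes> inv u = b"
    using kernel_commute[OF u(1) b(1) u(2) b(2)] u b by (simp add: m_assoc)
  moreover have "shift b l \<otimes> x = x \<otimes> t [^] ?i \<otimes> (u \<otimes> b \<otimes> inv u) \<otimes> t [^] (- ?i) \<otimes> (inv x \<otimes> x)"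
    unfolding shift_def tu itu using x u b by (simp add: m_assoc del: minus_diff_eq)
  ultimately show ?thesis
    unfolding shift_def using x b by (simp add: m_assoc del: minus_diff_eq)
qed

text \<open>
  A discrete intermediate value argument: one letter changes the level by at most \<open>J\<close>.
\<close>

lemma ball_passes_level:
  assumes J: "\<forall>y\<in>ball 1. \<bar>lev y\<bar> \<le> int J"
  shows "x \<in> ball n \<Longrightarrow> 0 \<le> l \<and> l \<le> lev x \<or> lev x \<le> l \<and> l \<le> 0 \<Longrightarrow>
    \<exists>n1\<le>n. \<exists>x1\<in>ball n1. \<exists>x2\<in>ball (n - n1). x = x1 \<otimes> x2 \<and> \<bar>l - lev x1\<bar> \<le> int J"
proof (induction n arbitrary: x)
  case 0
  then have "x = \<one>" "l = 0" by (auto simp: ball_0 lev_one)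
  then show ?case
    using one_in_ball by (intro exI[of _ 0] conjI bexI[of _ \<one>]) (auto simp: lev_one)
next
  case (Suc n)
  obtain x' y where xy: "x' \<in> ball n" "y \<in> ball 1" "x = x' \<otimes> y" using ball_SucE[OF Suc.prems(1)] .
  have c: "x' \<in> carrier G" "y \<in> carrier G" using xy by (auto intro: ball_closed)
  show ?case
  proof (cases "0 \<le> l \<and> l \<le> lev x' \<or> lev x' \<le> l \<and> l \<le> 0")
    case True
    then obtain n1 x1 x2 where x: "n1 \<le> n" "x1 \<in> ball n1" "x2 \<in> ball (n - n1)" "x' = x1 \<otimes> x2"
      "\<bar>l - lev x1\<bar> \<le> int J" using Suc.IH[OF xy(1)] by blast
    have "x2 \<otimes> y \<in> ball (Suc n - n1)" using ball_mult[OF x(3) xy(2)] x(1) by (simp add: Suc_diff_le)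
    moreover have "x = x1 \<otimes> (x2 \<otimes> y)" using xy x by (simp add: m_assoc ball_closed)
    ultimately show ?thesis using x by (metis le_SucI)
  next
    case False
    have "lev x = lev x' + lev y" using xy c by (simp add: lev_mult)
    moreover have "\<bar>lev y\<bar> \<le> int J" using J xy by blast
    ultimately have "\<bar>l - lev x\<bar> \<le> int J" using False Suc.prems(2) by linarith
    then show ?thesis
      using Suc.prems(1) one_in_ball ball_closed
      by (intro exI[of _ "Suc n"] conjI bexI[of _ x] bexI[of _ \<one>]) auto
  qed
qed

text \<open>
  Insert the conjugate where the word comes within \<open>J\<close> of level \<open>l\<close>; there it is one of finitely many
  elements, whence the constant cost \<open>D\<close>.
\<close>

lemma insert_shift:
  assumes J: "\<forall>y\<in>ball 1. \<bar>lev y\<bar> \<le> int J"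
    and b: "b \<in> carrier G" "lev b = 0"
    and D: "\<forall>i. \<bar>i\<bar> \<le> int J \<longrightarrow> shift b i \<in> ball D"
    and x: "x \<in> ball n"
    and l: "0 \<le> l \<and> l \<le> lev x \<or> lev x \<le> l \<and> l \<le> 0"
  shows "shift b l \<otimes> x \<in> ball (n + D)"
proof -
  obtain n1 x1 x2 where x12: "n1 \<le> n" "x1 \<in> ball n1" "x2 \<in> ball (n - n1)" "x = x1 \<otimes> x2"
    "\<bar>l - lev x1\<bar> \<le> int J" using ball_passes_level[OF J x l] by blast
  have c: "x1 \<in> carrier G" "x2 \<in> carrier G" using x12 by (auto intro: ball_closed)
  have "shift b l \<otimes> x = (shift b l \<otimes> x1) \<otimes> x2" using x12(4) c b by (simp add: m_assoc)
  also have "\<dots> = x1 \<otimes> shift b (l - lev x1) \<otimes> x2" using shift_through[OF b c(1)] by simp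
  also have "\<dots> \<in> ball (n1 + D + (n - n1))" using x12 D by (intro ball_mult) auto
  finally show ?thesis using x12(1) by (simp add: add.commute)
qed

lemma insert_shifts:
  assumes J: "\<forall>y\<in>ball 1. \<bar>lev y\<bar> \<le> int J"
    and b: "b \<in> carrier G" "lev b = 0"
    and D: "\<forall>i. \<bar>i\<bar> \<le> int J \<longrightarrow> shift b i \<in> ball D"
    and x: "x \<in> ball n"
  shows "\<forall>l\<in>set ls. 0 \<le> l \<and> l \<le> lev x \<or> lev x \<le> l \<and> l \<le> 0 \<Longrightarrow>
    shifts b ls \<otimes> x \<in> ball (n + D * length ls)"
proof (induction ls)
  case Nil
  then show ?case using x by (simp add: ball_closed)
next
  case (Cons l ls)
  have c: "x \<in> carrier G" using x by (rule ball_closed)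
  have "shifts b ls \<otimes> x \<in> ball (n + D * length ls)" using Cons by simp
  moreover have "lev (shifts b ls \<otimes> x) = lev x" using b c by (simp add: lev_mult lev_shifts)
  ultimately have "shift b l \<otimes> (shifts b ls \<otimes> x) \<in> ball (n + D * length ls + D)"
    using Cons.prems by (intro insert_shift[OF J b D]) auto
  then show ?case using b c by (simp add: m_assoc ac_simps)
qed

lemma shift_ball_exists:
  assumes "b \<in> carrier G"
  shows "\<exists>D. \<forall>i. \<bar>i\<bar> \<le> int J \<longrightarrow> shift b i \<in> ball D"
proof -
  have "finite (shift b ` {- int J .. int J})" by simp
  then obtain D where "shift b ` {- int J .. int J} \<subseteq> ball D"
    using finite_subset_ball[of "shift b ` {- int J .. int J}"] assms by (metis image_subsetI shift_closed)
  then show ?thesis by (intro exI[of _ D]) (auto simp: image_subset_iff abs_le_iff)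
qed

end

section \<open>Digit expansions\<close>

definition digit_strings :: "nat \<Rightarrow> nat \<Rightarrow> nat list set" where
  "digit_strings R j = {xs. set xs \<subseteq> {..<R} \<and> length xs = j}"

lemma card_digit_strings: "finite (digit_strings R j)" "card (digit_strings R j) = R ^ j"
  unfolding digit_strings_def using finite_lists_length_eq[of "{..<R}" j] card_lists_length_eq[of "{..<R}" j]
  by auto

text \<open>
  A digit string \<open>xs\<close>, most significant block first, selects one position in each block of length \<open>R\<close>:
  the block with index \<open>i\<close> from the right contributes \<open>R * i\<close> plus its digit.
\<close>

primrec positions :: "nat \<Rightarrow> nat list \<Rightarrow> nat list" where
  "positions R [] = []"
| "positions R (x # xs) = (R * length xs + x) # positions R xs"

lemma positions_length [simp]: "length (positions R xs) = length xs"
  by (induction xs) auto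

lemma positions_less:
  assumes "set xs \<subseteq> {..<R}" "p \<in> set (positions R xs)"
  shows "p < R * length xs"
  using assms
proof (induction xs)
  case (Cons x xs)
  show ?case
  proof (cases "p = R * length xs + x")
    case True
    then show ?thesis using Cons.prems by simp
  next
    case False
    then have "p < R * length xs" using Cons by auto
    then show ?thesis by (simp add: trans_less_add2)
  qed
qed simp

lemma norm_digit_sum:
  fixes z :: complex
  assumes z: "norm z \<ge> 3" and xs: "set xs \<subseteq> {..<R}"
  shows "2 * norm (\<Sum>p\<leftarrow>positions R xs. z ^ p) < norm z ^ (R * length xs)"
  using xs
proof (induction xs)
  case (Cons x xs)
  let ?L = "R * length xs"
  have x: "?L + x + 1 \<le> R * length (x # xs)" using Cons.prems by simp
  have "2 * norm (\<Sum>p\<leftarrow>positions R (x # xs). z ^ p)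
      \<le> 2 * norm z ^ (?L + x) + 2 * norm (\<Sum>p\<leftarrow>positions R xs. z ^ p)"
    using norm_triangle_ineq[of "z ^ (?L + x)" "\<Sum>p\<leftarrow>positions R xs. z ^ p"]
    by (simp add: norm_power)
  also have "\<dots> < 2 * norm z ^ (?L + x) + norm z ^ ?L" using Cons by simp
  also have "\<dots> \<le> 3 * norm z ^ (?L + x)"
    using z power_increasing[of ?L "?L + x" "norm z"] by simp
  also have "\<dots> \<le> norm z * norm z ^ (?L + x)" using z by (intro mult_right_mono) auto
  also have "\<dots> = norm z ^ (?L + x + 1)" by simp
  also have "\<dots> \<le> norm z ^ (R * length (x # xs))"
    using z x by (intro power_increasing) auto
  finally show ?case .
qed simp

text \<open>
  If the leading digits differ, so do the largest powers, by more than all smaller powers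
  can make up for, since \<open>norm z\<close> is at least three.
\<close>

lemma digit_sum_head:
  fixes z :: complex
  assumes z: "norm z \<ge> 3" and xs: "set xs \<subseteq> {..<R}" "set ys \<subseteq> {..<R}" "length xs = length ys"
    and less: "x < y"
  shows "(\<Sum>p\<leftarrow>positions R (x # xs). z ^ p) \<noteq> (\<Sum>p\<leftarrow>positions R (y # ys). z ^ p)"
proof
  let ?S = "\<lambda>xs. \<Sum>p\<leftarrow>positions R xs. z ^ p"
  let ?L = "R * length xs"
  assume "?S (x # xs) = ?S (y # ys)"
  then have "z ^ (?L + y) = z ^ (?L + x) + (?S xs - ?S ys)" using xs(3) by (simp add: algebra_simps)
  then have "norm z ^ (?L + y) \<le> norm z ^ (?L + x) + norm (?S xs - ?S ys)"
    using norm_triangle_ineq[of "z ^ (?L + x)" "?S xs - ?S ys"] by (metis norm_power)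
  also have "\<dots> \<le> norm z ^ (?L + x) + (norm (?S xs) + norm (?S ys))"
    using norm_triangle_ineq4[of "?S xs" "?S ys"] by simp
  also have "\<dots> < norm z ^ (?L + x) + norm z ^ ?L"
    using norm_digit_sum[OF z xs(1)] norm_digit_sum[OF z xs(2)] xs(3) by simp
  also have "\<dots> \<le> 3 * norm z ^ (?L + x)"
    using z power_increasing[of ?L "?L + x" "norm z"] zero_le_power[of "norm z" "?L + x"] by linarith
  also have "\<dots> \<le> norm z * norm z ^ (?L + x)" using z by (intro mult_right_mono) auto
  also have "\<dots> = norm z ^ (?L + x + 1)" by simp
  also have "\<dots> \<le> norm z ^ (?L + y)" using z less by (intro power_increasing) auto
  finally show False by simp
qed

lemma digit_sum_inj:
  fixes z :: complex
  assumes z: "norm z \<ge> 3"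
  shows "inj_on (\<lambda>xs. \<Sum>p\<leftarrow>positions R xs. z ^ p) (digit_strings R j)"
proof (induction j)
  case 0
  show ?case by (auto simp: digit_strings_def inj_on_def)
next
  case (Suc j)
  show ?case
  proof (rule inj_onI)
    fix us vs assume us: "us \<in> digit_strings R (Suc j)" and vs: "vs \<in> digit_strings R (Suc j)"
      and eq: "(\<Sum>p\<leftarrow>positions R us. z ^ p) = (\<Sum>p\<leftarrow>positions R vs. z ^ p)"
    obtain x xs where x: "us = x # xs" "xs \<in> digit_strings R j"
      using us by (cases us) (auto simp: digit_strings_def)
    obtain y ys where y: "vs = y # ys" "ys \<in> digit_strings R j"
      using vs by (cases vs) (auto simp: digit_strings_def)
    have len: "set xs \<subseteq> {..<R}" "set ys \<subseteq> {..<R}" "length xs = length ys"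
      using x y by (auto simp: digit_strings_def)
    have "x = y"
      using digit_sum_head[OF z len, of x y] digit_sum_head[OF z len(2,1) len(3)[symmetric], of y x] eq x y
      by (metis linorder_less_linear)
    then have "(\<Sum>p\<leftarrow>positions R xs. z ^ p) = (\<Sum>p\<leftarrow>positions R ys. z ^ p)" using eq x y len by simp
    then have "xs = ys" using inj_onD[OF Suc.IH] x y by blast
    then show "us = vs" using \<open>x = y\<close> x y by simp
  qed
qed

section \<open>Counting words that reach a far level\<close>

text \<open>
  \<open>psi\<close> is the translation part of a homomorphism to the affine maps of the complex plane whose linear
  part is \<open>lam powi lev x\<close>, and \<open>b\<close> is a kernel element that it does not kill.
\<close>

locale expanding_mapping_torus = fg_mapping_torus G m T t E lev Y
  for G (structure) and m T t E lev Y +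
  fixes lam :: complex and psi :: "'a \<Rightarrow> complex" and b :: 'a
  assumes lam: "norm lam > 1"
    and psi_mult: "x \<in> carrier G \<Longrightarrow> y \<in> carrier G \<Longrightarrow> psi (x \<otimes> y) = psi x + lam powi lev x * psi y"
    and b: "b \<in> carrier G" "lev b = 0" "psi b \<noteq> 0"
begin

lemma lam_nz: "lam \<noteq> 0"
  using lam by auto

lemma psi_one: "psi \<one> = 0"
  using psi_mult[of \<one> \<one>] by (simp add: lev_one)

lemma psi_inv: "x \<in> carrier G \<Longrightarrow> psi (inv x) = - (lam powi (- lev x) * psi x)"
  using psi_mult[of "inv x" x] by (simp add: psi_one lev_inv eq_neg_iff_add_eq_0)

lemma psi_shift: "psi (shift b l) = lam powi l * psi b"
proof -
  have "psi (t [^] l) + lam powi l * psi (t [^] (- l)) = 0"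
    using psi_mult[of "t [^] l" "t [^] (- l)"] by (simp add: t_pow_cancel psi_one lev_t_pow)
  then show ?thesis
    using b by (simp add: shift_def psi_mult lev_mult lev_t_pow algebra_simps)
qed

lemma psi_shifts: "psi (shifts b ls) = (\<Sum>l\<leftarrow>ls. lam powi l) * psi b"
  using b by (induction ls) (simp_all add: psi_one psi_mult psi_shift lev_shift algebra_simps)

text \<open>
  The product of conjugates of \<open>b\<close> encoded by a digit string. Marked levels are \<open>s\<close> apart, where
  \<open>s\<close> will be chosen such that \<open>lam ^ s\<close> has norm at least three.
\<close>

definition insertion :: "int \<Rightarrow> nat \<Rightarrow> nat \<Rightarrow> nat list \<Rightarrow> 'a" where
  "insertion l0 s R xs = shifts b (map (\<lambda>p. l0 + int (s * p)) (positions R xs))"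

lemma insertion_closed [simp]: "insertion l0 s R xs \<in> carrier G"
  using b by (simp add: insertion_def)

lemma lev_insertion [simp]: "lev (insertion l0 s R xs) = 0"
  using b by (simp add: insertion_def lev_shifts)

lemma psi_insertion_inj:
  assumes s: "norm lam ^ s \<ge> 3"
  shows "inj_on (\<lambda>xs. psi (insertion l0 s R xs)) (digit_strings R j)"
proof (rule inj_onI)
  fix xs ys assume xy: "xs \<in> digit_strings R j" "ys \<in> digit_strings R j"
    "psi (insertion l0 s R xs) = psi (insertion l0 s R ys)"
  have eq: "psi (insertion l0 s R zs) = lam powi l0 * (\<Sum>p\<leftarrow>positions R zs. (lam ^ s) ^ p) * psi b" for zs
  proof -
    have "lam powi (l0 + int (s * p)) = lam powi l0 * (lam ^ s) ^ p" for p
      using lam_nz by (simp add: power_int_add power_mult del: of_nat_mult)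
    then show ?thesis
      unfolding insertion_def psi_shifts by (simp add: comp_def sum_list_const_mult del: of_nat_mult)
  qed
  have "(\<Sum>p\<leftarrow>positions R xs. (lam ^ s) ^ p) = (\<Sum>p\<leftarrow>positions R ys. (lam ^ s) ^ p)"
    using xy(3) b lam_nz by (simp add: eq power_int_eq_0_iff)
  then show "xs = ys"
    using digit_sum_inj[of "lam ^ s"] s xy(1,2) by (auto simp: norm_power dest: inj_onD)
qed

lemma insertion_ball:
  assumes J: "\<forall>y\<in>ball 1. \<bar>lev y\<bar> \<le> int J"
    and D: "\<forall>i. \<bar>i\<bar> \<le> int J \<longrightarrow> shift b i \<in> ball D"
    and x: "x \<in> ball n"
    and xs: "xs \<in> digit_strings R j"
    and N: "s * (R * j) \<le> N"
    and l0: "l0 = 0 \<and> int N \<le> lev x \<or> l0 = - int N \<and> lev x \<le> - int N"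
  shows "insertion l0 s R xs \<otimes> x \<in> ball (n + D * j)"
proof -
  have len: "length xs = j" using xs by (simp add: digit_strings_def)
  have "0 \<le> l \<and> l \<le> lev x \<or> lev x \<le> l \<and> l \<le> 0"
    if l: "l \<in> set (map (\<lambda>p. l0 + int (s * p)) (positions R xs))" for l
  proof -
    obtain p where p: "p \<in> set (positions R xs)" "l = l0 + int (s * p)" using l by auto
    have "p < R * j" using positions_less[of xs R p] p xs by (auto simp: digit_strings_def)
    then have "s * p \<le> N" using N by (meson less_imp_le_nat mult_le_mono2 order_trans)
    then have "int (s * p) \<le> int N" by (simp only: of_nat_le_iff)
    moreover have "0 \<le> int (s * p)" by simp
    ultimately show ?thesis using l0 p(2) by linarith
  qed
  then show ?thesis
    unfolding insertion_def
    using insert_shifts[OF J b(1,2) D x, of "map (\<lambda>p. l0 + int (s * p)) (positions R xs)"] len by simp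
qed

definition beyond :: "bool \<Rightarrow> nat \<Rightarrow> int set" where
  "beyond up N = (if up then {int N..} else {..- int N})"

text \<open>
  For words that reach a low level, the marked levels are counted upwards from \<open>- N\<close> rather than
  downwards from zero, so that the same digit expansion with a base of norm above one applies.
\<close>

definition base_level :: "bool \<Rightarrow> nat \<Rightarrow> int" where
  "base_level up N = (if up then 0 else - int N)"

text \<open>
  The insertion leaves the level of \<open>g\<close> unchanged, so two modified elements that agree come from
  elements with the same value of \<open>psi\<close>. Comparing \<open>psi\<close> identifies the insertions, and then the
  elements.
\<close>

lemma card_fibre_far:
  assumes J: "\<forall>y\<in>ball 1. \<bar>lev y\<bar> \<le> int J"
    and D: "\<forall>i. \<bar>i\<bar> \<le> int J \<longrightarrow> shift b i \<in> ball D"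
    and s: "norm lam ^ s \<ge> 3"
    and N: "s * (R * j) \<le> N"
  shows "card {g \<in> far (beyond up N) n. psi g = c (lev g)} * R ^ j \<le> card (ball (n + D * j))"
proof -
  let ?F = "{g \<in> far (beyond up N) n. psi g = c (lev g)}"
  let ?ins = "insertion (base_level up N) s R"
  have carr: "g \<in> carrier G" if "g \<in> ?F" for g
    using that far_ball ball_closed by blast
  have "inj_on (\<lambda>(g, xs). ?ins xs \<otimes> g) (?F \<times> digit_strings R j)"
  proof (rule inj_onI, clarsimp)
    fix g xs g' xs'
    assume a: "g \<in> far (beyond up N) n" "psi g = c (lev g)" "xs \<in> digit_strings R j"
      "g' \<in> far (beyond up N) n" "psi g' = c (lev g')" "xs' \<in> digit_strings R j"
      "?ins xs \<otimes> g = ?ins xs' \<otimes> g'"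
    have g: "g \<in> carrier G" "g' \<in> carrier G" using a carr by auto
    have "lev g = lev g'" using arg_cong[OF a(7), of lev] g by (simp add: lev_mult)
    then have "psi g = psi g'" using a by simp
    then have "psi (?ins xs) = psi (?ins xs')" using arg_cong[OF a(7), of psi] g by (simp add: psi_mult)
    then have "xs = xs'" using psi_insertion_inj[OF s] a by (auto dest: inj_onD)
    then show "g = g' \<and> xs = xs'" using a(7) g by simp
  qed
  moreover have "(\<lambda>(g, xs). ?ins xs \<otimes> g) ` (?F \<times> digit_strings R j) \<subseteq> ball (n + D * j)"
  proof (clarsimp)
    fix g xs assume g: "g \<in> far (beyond up N) n" and xs: "xs \<in> digit_strings R j"
    obtain n1 x y where x: "n1 \<le> n" "x \<in> ball n1" "y \<in> ball (n - n1)" "g = x \<otimes> y" "lev x \<in> beyond up N"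
      using g unfolding far_def by blast
    have "?ins xs \<otimes> x \<in> ball (n1 + D * j)"
      using x(5) by (intro insertion_ball[OF J D x(2) xs N]) (auto simp: beyond_def base_level_def)
    then have "?ins xs \<otimes> x \<otimes> y \<in> ball (n1 + D * j + (n - n1))" using x(3) by (rule ball_mult)
    then show "?ins xs \<otimes> g \<in> ball (n + D * j)" using x by (simp add: m_assoc ball_closed add.commute)
  qed
  ultimately have "card (?F \<times> digit_strings R j) \<le> card (ball (n + D * j))"
    using finite_ball by (rule card_inj_on_le)
  then show ?thesis by (simp add: card_cartesian_product card_digit_strings)
qed

text \<open>
  Cut a word for \<open>g\<close> of level zero where it reaches the far level: \<open>g = x \<otimes> inv y\<close>, with \<open>x\<close> and \<open>y\<close> on
  that level, so the same insertion fits both. The quotient of the modified pair is conjugate to \<open>g\<close> by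
  a kernel element, hence equal to \<open>g\<close>; this recovers \<open>g\<close>, then the chosen \<open>x\<close>, then the insertion.
\<close>

lemma card_kernel_far:
  assumes J: "\<forall>y\<in>ball 1. \<bar>lev y\<bar> \<le> int J"
    and D: "\<forall>i. \<bar>i\<bar> \<le> int J \<longrightarrow> shift b i \<in> ball D"
    and s: "norm lam ^ s \<ge> 3"
    and N: "s * (R * j) \<le> N"
  shows "card {g \<in> far (beyond up N) n. lev g = 0} * R ^ j
    \<le> (\<Sum>n1\<le>n. card (ball (n1 + D * j)) * card (ball (n - n1 + D * j)))"
proof -
  let ?F = "{g \<in> far (beyond up N) n. lev g = 0}"
  let ?ins = "insertion (base_level up N) s R"
  let ?X = "SIGMA n1:{..n}. ball (n1 + D * j) \<times> ball (n - n1 + D * j)"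
  define P where "P g = (\<lambda>(n1, x, y). n1 \<le> n \<and> x \<in> ball n1 \<and> y \<in> ball (n - n1) \<and>
      g = x \<otimes> inv y \<and> lev x \<in> beyond up N \<and> lev y = lev x)" for g
  have "\<forall>g\<in>?F. \<exists>w. P g w"
  proof
    fix g assume g: "g \<in> ?F"
    then obtain n1 x y where x: "n1 \<le> n" "x \<in> ball n1" "y \<in> ball (n - n1)" "g = x \<otimes> y"
      "lev x \<in> beyond up N" unfolding far_def by blast
    have "lev x + lev y = 0" using g x by (simp add: lev_mult ball_closed)
    then have "lev (inv y) = lev x" using x by (simp add: lev_inv ball_closed)
    moreover have "inv y \<in> ball (n - n1)" "g = x \<otimes> inv (inv y)"
      using x by (auto simp: ball_inv ball_closed)
    ultimately have "P g (n1, x, inv y)" using x by (simp add: P_def)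
    then show "\<exists>w. P g w" ..
  qed
  then obtain w where w: "\<forall>g\<in>?F. P g (w g)" using bchoice[of ?F P] by blast
  define n1 x y where "n1 g = fst (w g)" and "x g = fst (snd (w g))" and "y g = snd (snd (w g))" for g
  have xy: "n1 g \<le> n \<and> x g \<in> ball (n1 g) \<and> y g \<in> ball (n - n1 g) \<and> g = x g \<otimes> inv (y g) \<and>
      lev (x g) \<in> beyond up N \<and> lev (y g) = lev (x g)" if "g \<in> ?F" for g
    using bspec[OF w that] by (simp add: P_def n1_def x_def y_def split: prod.splits)
  have carr: "x g \<in> carrier G" "y g \<in> carrier G" if "g \<in> ?F" for g
    using xy[OF that] ball_closed by blast+
  define f where "f = (\<lambda>(g, xs). (n1 g, ?ins xs \<otimes> x g, ?ins xs \<otimes> y g))"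
  \<comment> \<open>The pair determines \<open>g\<close>: the common insertion cancels up to conjugation by a kernel element.\<close>
  have recover: "(?ins xs \<otimes> x g) \<otimes> inv (?ins xs \<otimes> y g) = g" if g: "g \<in> ?F" for g xs
  proof -
    have gc: "g \<in> carrier G" using xy[OF g] carr[OF g] by (metis inv_closed m_closed)
    have "(?ins xs \<otimes> x g) \<otimes> inv (?ins xs \<otimes> y g) = ?ins xs \<otimes> (x g \<otimes> inv (y g)) \<otimes> inv (?ins xs)"
      using carr[OF g] by (simp add: inv_mult_group m_assoc)
    also have "\<dots> = ?ins xs \<otimes> g \<otimes> inv (?ins xs)" using xy[OF g] by metis
    also have "\<dots> = g"
      using kernel_commute[of "?ins xs" g] g gc by (simp add: m_assoc)
    finally show ?thesis .
  qed
  have "inj_on f (?F \<times> digit_strings R j)"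
  proof (rule inj_onI)
    fix u u' assume u: "u \<in> ?F \<times> digit_strings R j" "u' \<in> ?F \<times> digit_strings R j" "f u = f u'"
    obtain g xs g' xs' where e: "u = (g, xs)" "u' = (g', xs')" by fastforce
    have g: "g \<in> ?F" "g' \<in> ?F" and xs: "xs \<in> digit_strings R j" "xs' \<in> digit_strings R j"
      using u e by auto
    have eq: "?ins xs \<otimes> x g = ?ins xs' \<otimes> x g'" "?ins xs \<otimes> y g = ?ins xs' \<otimes> y g'"
      using u(3) by (auto simp: f_def e)
    then have gg: "g = g'" using recover[OF g(1), of xs] recover[OF g(2), of xs'] by simp
    then have "?ins xs = ?ins xs'" using eq(1) carr[OF g(1)] by simp
    then have "xs = xs'" using psi_insertion_inj[OF s] xs by (metis inj_onD)
    then show "u = u'" using gg e by simp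
  qed
  moreover have "f ` (?F \<times> digit_strings R j) \<subseteq> ?X"
  proof
    fix z assume "z \<in> f ` (?F \<times> digit_strings R j)"
    then obtain g xs where g: "g \<in> ?F" and xs: "xs \<in> digit_strings R j" and z: "z = f (g, xs)" by blast
    have "?ins xs \<otimes> x g \<in> ball (n1 g + D * j)"
      using xy[OF g] by (intro insertion_ball[OF J D _ xs N]) (auto simp: beyond_def base_level_def)
    moreover have "?ins xs \<otimes> y g \<in> ball (n - n1 g + D * j)"
      using xy[OF g] by (intro insertion_ball[OF J D _ xs N]) (auto simp: beyond_def base_level_def)
    ultimately show "z \<in> ?X" using xy[OF g] by (simp add: z f_def)
  qed
  moreover have "finite ?X" by (simp add: finite_ball)
  ultimately have "card (?F \<times> digit_strings R j) \<le> card ?X" by (rule card_inj_on_le)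
  then show ?thesis by (simp add: card_cartesian_product card_digit_strings finite_ball)
qed

lemma card_cover:
  assumes cover: "ball n \<subseteq> far {k. int N \<le> \<bar>k\<bar>} n \<union> near N K M"
  shows "card {g \<in> ball n. P g} \<le> card (near N K M) +
    (card {g \<in> far (beyond True N) n. P g} + card {g \<in> far (beyond False N) n. P g})"
proof -
  have fin: "finite {g \<in> far S n. P g}" for S
    using far_ball finite_ball by (rule_tac finite_subset[of _ "ball n"]) auto
  have "{g \<in> ball n. P g} \<subseteq> near N K M \<union> ({g \<in> far (beyond True N) n. P g} \<union> {g \<in> far (beyond False N) n. P g})"
  proof
    fix g assume g: "g \<in> {g \<in> ball n. P g}"
    show "g \<in> near N K M \<union> ({g \<in> far (beyond True N) n. P g} \<union> {g \<in> far (beyond False N) n. P g})"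
    proof (cases "g \<in> near N K M")
      case False
      then have "g \<in> far {k. int N \<le> \<bar>k\<bar>} n" using g cover by blast
      then obtain n1 x y where x: "n1 \<le> n" "x \<in> ball n1" "y \<in> ball (n - n1)" "g = x \<otimes> y"
        "int N \<le> \<bar>lev x\<bar>" unfolding far_def by blast
      then have "lev x \<in> beyond True N \<or> lev x \<in> beyond False N" by (auto simp: beyond_def)
      then have "g \<in> far (beyond True N) n \<or> g \<in> far (beyond False N) n"
        using x unfolding far_def by blast
      then show ?thesis using g by blast
    qed simp
  qed
  then have "card {g \<in> ball n. P g} \<le>
      card (near N K M \<union> ({g \<in> far (beyond True N) n. P g} \<union> {g \<in> far (beyond False N) n. P g}))"
    using fin card_near(1) by (intro card_mono) auto
  also have "\<dots> \<le> card (near N K M) +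
      card ({g \<in> far (beyond True N) n. P g} \<union> {g \<in> far (beyond False N) n. P g})"
    by (rule card_Un_le)
  also have "\<dots> \<le> card (near N K M) +
    (card {g \<in> far (beyond True N) n. P g} + card {g \<in> far (beyond False N) n. P g})"
    by (intro add_left_mono card_Un_le)
  finally show ?thesis .
qed

text \<open>
  With \<open>W = Q * (s * R)\<close> the \<open>n div W\<close> blocks of \<open>R\<close> marked levels fit below level \<open>n div Q\<close>. The
  insertions cost at most a factor of the ball of radius \<open>D\<close> per block for one element, and its square
  for a pair. Taking \<open>R\<close> as twice that square leaves a gain of one half per block in both cases. For
  the kernel, the loss \<open>(1 / sqrt q) ^ n\<close> in Fekete's lemma uses up only half of this gain.
\<close>

lemma fibre_and_kernel_negligible:
  assumes c: "c > 1" "\<And>n. c ^ n \<le> real (card (ball n))"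
  shows "\<exists>f. exp_small f \<and>
    (\<forall>n v. real (card {g \<in> ball n. psi g = v (lev g)}) \<le> f n * real (card (ball n))) \<and>
    (\<forall>n. real (card {g \<in> ball n. lev g = 0}) \<le> f n * real (card (ball n)))"
proof -
  obtain Q K M where Q: "Q \<ge> 1"
    and cover: "\<And>n. ball n \<subseteq> far {k. int (n div Q) \<le> \<bar>k\<bar>} n \<union> near (n div Q) K (M n)"
    and near: "exp_small (\<lambda>n. real (card (near (n div Q) K (M n))) / real (card (ball n)))"
    using near_negligible[OF c] by blast
  obtain J where J: "\<forall>y\<in>ball 1. \<bar>lev y\<bar> \<le> int J" using lev_bounded by blast
  obtain D where D: "\<forall>i. \<bar>i\<bar> \<le> int J \<longrightarrow> shift b i \<in> ball D" using shift_ball_exists[OF b(1)] by blast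
  obtain s where s: "norm lam ^ s > 3" using real_arch_pow[OF lam] by blast
  then have s0: "s \<ge> 1" by (cases s) auto
  define R where "R = 2 * card (ball D) ^ 2"
  have R1: "R \<ge> 1" using card_ball_pos[of D] by (simp add: R_def)
  define W where "W = Q * (s * R)"
  have W: "W \<ge> 1" using Q s0 R1 by (simp add: W_def)
  define q where "q = root W (1 / 2)"
  have q: "0 < q" "q < 1" "\<And>n. (1 / 2) ^ (n div W) \<le> 2 * q ^ n"
    using half_power_div[OF W] by (auto simp: q_def)
  let ?c = "\<lambda>n. real (card (ball n))"
  have c1: "?c n \<ge> 1" for n using card_ball_pos[of n] by simp
  have N: "s * (R * (n div W)) \<le> n div Q" for n
    by (metis W_def div_mult2_eq mult.assoc times_div_less_eq_dividend)
  have cD: "?c (a + D * j) \<le> ?c a * ?c D ^ j" for a j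
  proof -
    have "card (ball (a + D * j)) \<le> card (ball a) * card (ball D) ^ j"
      using card_ball_add[of a "D * j"] card_ball_mult[of D j] by (meson mult_le_mono2 order_trans)
    then show ?thesis by (simp only: of_nat_le_iff flip: of_nat_mult of_nat_power)
  qed
  have Rj: "real R ^ j = 2 ^ j * ?c D ^ j * ?c D ^ j" for j
    by (simp add: R_def power_mult_distrib power2_eq_square)
  have halve: "X \<le> (1 / 2) ^ j * Z" if "X * 2 ^ j \<le> Z" for X Z :: real and j
    using that by (simp add: power_one_over field_simps)
  have fibre: "real (card {g \<in> far (beyond up (n div Q)) n. psi g = v (lev g)}) \<le> 2 * q ^ n * ?c n"
    for up n v
  proof -
    let ?j = "n div W" and ?X = "real (card {g \<in> far (beyond up (n div Q)) n. psi g = v (lev g)})"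
    have "?X * real R ^ ?j \<le> ?c (n + D * ?j)"
      using card_fibre_far[OF J D less_imp_le[OF s] N[of n], of up n v]
      by (simp only: of_nat_le_iff flip: of_nat_mult of_nat_power)
    also have "\<dots> \<le> ?c n * ?c D ^ ?j" by (rule cD)
    also have "\<dots> \<le> ?c n * ?c D ^ ?j * ?c D ^ ?j"
      using mult_left_mono[of 1 "?c D ^ ?j" "?c n * ?c D ^ ?j"] c1 by (simp add: one_le_power)
    finally have "?X * 2 ^ ?j * (?c D ^ ?j * ?c D ^ ?j) \<le> ?c n * (?c D ^ ?j * ?c D ^ ?j)"
      by (simp add: Rj mult.assoc)
    then have "?X * 2 ^ ?j \<le> ?c n"
      by (rule mult_right_le_imp_le) (use c1[of D] in simp)
    then have "?X \<le> (1 / 2) ^ ?j * ?c n" by (rule halve)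
    also have "\<dots> \<le> 2 * q ^ n * ?c n" using q(3) by (intro mult_right_mono) auto
    finally show ?thesis .
  qed
  let ?r = "sqrt q"
  have r: "0 < ?r" "?r < 1" "?r * ?r = q" using q by auto
  obtain C where C: "C \<ge> 0" "\<And>a b. ?c a * ?c b \<le> C * (1 / ?r) ^ (a + b) * ?c (a + b)"
    using ball_growth_regular[of "1 / ?r"] r by auto
  have kernel: "real (card {g \<in> far (beyond up (n div Q)) n. lev g = 0})
      \<le> real (1 * n + 1) * (2 * C * ?r ^ n) * ?c n" for up n
  proof -
    let ?j = "n div W" and ?X = "real (card {g \<in> far (beyond up (n div Q)) n. lev g = 0})"
    have "card {g \<in> far (beyond up (n div Q)) n. lev g = 0} * R ^ ?j
      \<le> (\<Sum>n1\<le>n. card (ball (n1 + D * ?j)) * card (ball (n - n1 + D * ?j)))"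
      by (rule card_kernel_far[OF J D less_imp_le[OF s] N[of n]])
    then have "?X * real R ^ ?j
        \<le> real (\<Sum>n1\<le>n. card (ball (n1 + D * ?j)) * card (ball (n - n1 + D * ?j)))"
      by (simp only: of_nat_le_iff flip: of_nat_mult of_nat_power)
    also have "\<dots> = (\<Sum>n1\<le>n. ?c (n1 + D * ?j) * ?c (n - n1 + D * ?j))" by simp
    also have "\<dots> \<le> (\<Sum>n1\<le>n. C * (1 / ?r) ^ n * ?c n * (?c D ^ ?j * ?c D ^ ?j))"
    proof (rule sum_mono)
      fix n1 assume n1: "n1 \<in> {..n}"
      have "?c (n1 + D * ?j) * ?c (n - n1 + D * ?j) \<le> (?c n1 * ?c D ^ ?j) * (?c (n - n1) * ?c D ^ ?j)"
        by (intro mult_mono cD) auto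
      also have "\<dots> = (?c n1 * ?c (n - n1)) * (?c D ^ ?j * ?c D ^ ?j)" by simp
      also have "\<dots> \<le> (C * (1 / ?r) ^ n * ?c n) * (?c D ^ ?j * ?c D ^ ?j)"
        using C(2)[of n1 "n - n1"] n1 by (intro mult_right_mono) auto
      finally show "?c (n1 + D * ?j) * ?c (n - n1 + D * ?j)
          \<le> C * (1 / ?r) ^ n * ?c n * (?c D ^ ?j * ?c D ^ ?j)" .
    qed
    also have "\<dots> = real (1 * n + 1) * (C * (1 / ?r) ^ n) * ?c n * (?c D ^ ?j * ?c D ^ ?j)" by simp
    finally have "?X * 2 ^ ?j * (?c D ^ ?j * ?c D ^ ?j)
        \<le> real (1 * n + 1) * (C * (1 / ?r) ^ n) * ?c n * (?c D ^ ?j * ?c D ^ ?j)"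
      by (simp only: Rj mult.assoc)
    then have "?X * 2 ^ ?j \<le> real (1 * n + 1) * (C * (1 / ?r) ^ n) * ?c n"
      by (rule mult_right_le_imp_le) (use c1[of D] in simp)
    then have "?X \<le> (1 / 2) ^ ?j * (real (1 * n + 1) * (C * (1 / ?r) ^ n) * ?c n)"
      by (rule halve)
    also have "\<dots> \<le> (2 * q ^ n) * (real (1 * n + 1) * (C * (1 / ?r) ^ n) * ?c n)"
      using q(3) C(1) r by (intro mult_right_mono) auto
    also have "q ^ n = ?r ^ n * ?r ^ n" using r(3) by (simp flip: power_mult_distrib)
    also have "2 * (?r ^ n * ?r ^ n) * (real (1 * n + 1) * (C * (1 / ?r) ^ n) * ?c n)
        = real (1 * n + 1) * (2 * C * ?r ^ n) * ?c n * (?r ^ n * (1 / ?r) ^ n)" by (simp only: ac_simps)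
    also have "?r ^ n * (1 / ?r) ^ n = 1" using r(1) by (simp flip: power_mult_distrib)
    finally show ?thesis by simp
  qed
  define f where "f n = real (card (near (n div Q) K (M n))) / ?c n
    + (4 * q ^ n + 2 * (real (1 * n + 1) * (2 * C * ?r ^ n)))" for n
  have "exp_small f"
    unfolding f_def using near q r C(1)
    by (intro exp_small_add exp_small_cmult exp_small_linear exp_small_power near) auto
  moreover have "real (card {g \<in> ball n. psi g = v (lev g)}) \<le> f n * ?c n" for n v
  proof -
    have "real (card {g \<in> ball n. psi g = v (lev g)}) \<le> real (card (near (n div Q) K (M n)))
      + (real (card {g \<in> far (beyond True (n div Q)) n. psi g = v (lev g)})
      + real (card {g \<in> far (beyond False (n div Q)) n. psi g = v (lev g)}))"
      using card_cover[OF cover, of n "\<lambda>g. psi g = v (lev g)"] by linarith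
    also have "\<dots> \<le> real (card (near (n div Q) K (M n))) + 4 * q ^ n * ?c n"
      using fibre[of True n v] fibre[of False n v] by simp
    also have "\<dots> \<le> f n * ?c n"
    proof -
      have "0 \<le> real (1 * n + 1) * (2 * C * ?r ^ n) * ?c n"
        using C(1) r by (intro mult_nonneg_nonneg) auto
      then show ?thesis using c1[of n] by (simp add: f_def distrib_right)
    qed
    finally show ?thesis .
  qed
  moreover have "real (card {g \<in> ball n. lev g = 0}) \<le> f n * ?c n" for n
  proof -
    have "real (card {g \<in> ball n. lev g = 0}) \<le> real (card (near (n div Q) K (M n)))
      + (real (card {g \<in> far (beyond True (n div Q)) n. lev g = 0})
      + real (card {g \<in> far (beyond False (n div Q)) n. lev g = 0}))"
      using card_cover[OF cover, of n "\<lambda>g. lev g = 0"] by linarith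
    also have "\<dots> \<le> real (card (near (n div Q) K (M n))) + 2 * (real (1 * n + 1) * (2 * C * ?r ^ n)) * ?c n"
      using kernel[of True n] kernel[of False n] by linarith
    also have "\<dots> \<le> f n * ?c n"
    proof -
      have "0 \<le> 4 * q ^ n * ?c n" using q by simp
      then show ?thesis using c1[of n] by (simp add: f_def distrib_right)
    qed
    finally show ?thesis .
  qed
  ultimately show ?thesis by blast
qed

end

section \<open>Vanishing commutators\<close>

text \<open>
  Fubini counting: the condition \<open>P\<close> sees the other coordinates as a parameter.
\<close>

lemma card_PiE_coordinate:
  assumes B: "finite B" and i: "i < s"
    and F: "\<And>y. real (card {v \<in> B. P y v}) \<le> F * real (card B)"
  shows "real (card {x \<in> {..<s} \<rightarrow>\<^sub>E B. P (restrict x ({..<s} - {i})) (x i)}) \<le> F * real (card B) ^ s"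
proof -
  let ?X = "{x \<in> {..<s} \<rightarrow>\<^sub>E B. P (restrict x ({..<s} - {i})) (x i)}"
  let ?R = "({..<s} - {i}) \<rightarrow>\<^sub>E B"
  let ?S = "SIGMA y:?R. {v \<in> B. P y v}"
  define f where "f x = (restrict x ({..<s} - {i}), x i)" for x :: "nat \<Rightarrow> 'a"
  have "inj_on f ?X"
  proof (rule inj_onI)
    fix x y assume xy: "x \<in> ?X" "y \<in> ?X" "f x = f y"
    show "x = y"
    proof
      fix j
      show "x j = y j"
      proof (cases "j < s \<and> j \<noteq> i")
        case True
        have "fst (f x) j = fst (f y) j" using xy(3) by simp
        then show ?thesis using True by (simp add: f_def)
      next
        case False
        then show ?thesis using xy by (cases "j = i") (auto simp: f_def PiE_def extensional_def)
      qed
    qed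
  qed
  moreover have "f ` ?X \<subseteq> ?S"
  proof
    fix z assume "z \<in> f ` ?X"
    then obtain x where x: "x \<in> {..<s} \<rightarrow>\<^sub>E B" "P (restrict x ({..<s} - {i})) (x i)" "z = f x" by blast
    have "x j \<in> B" if "j < s" for j using PiE_mem[OF x(1)] that by simp
    then have "restrict x ({..<s} - {i}) \<in> ?R" "x i \<in> B" using i by simp_all
    then show "z \<in> ?S" using x(2,3) by (simp add: f_def)
  qed
  moreover have fin: "finite ?R" using B by (intro finite_PiE) auto
  moreover have "finite ?S" using fin B by auto
  ultimately have "card ?X \<le> card ?S" by (meson card_inj_on_le)
  also have "card ?S = (\<Sum>y\<in>?R. card {v \<in> B. P y v})" using fin B by simp
  finally have "real (card ?X) \<le> (\<Sum>y\<in>?R. real (card {v \<in> B. P y v}))"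
    by (simp flip: of_nat_sum)
  also have "\<dots> \<le> (\<Sum>y\<in>?R. F * real (card B))" by (intro sum_mono F)
  also have "\<dots> = F * (real (card B) * real (card ?R))" by simp
  also have "card ?R = card B ^ (s - 1)" using i by (simp add: card_PiE)
  also have "real (card B) * real (card B ^ (s - 1)) = real (card B) ^ s"
    using i by (cases s) auto
  finally show ?thesis .
qed

lemma (in group) commutator_closed:
  "x \<in> carrier G \<Longrightarrow> y \<in> carrier G \<Longrightarrow> commutator G x y \<in> carrier G"
  by (simp add: commutator_def)

lemma (in group) iter_commutator_closed:
  "(\<And>i. i \<le> r \<Longrightarrow> x i \<in> carrier G) \<Longrightarrow> iter_commutator G x r \<in> carrier G"
  by (induction r) (simp_all add: commutator_closed)

context expanding_mapping_torus
begin

lemma lam_powi_neq_one: "k \<noteq> 0 \<Longrightarrow> lam powi k \<noteq> 1"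
proof
  assume k: "k \<noteq> 0" and eq: "lam powi k = 1"
  have "norm lam powi k = 1" using eq by (metis norm_one norm_power_int)
  then have "norm lam powi \<bar>k\<bar> = 1"
    by (cases "k \<ge> 0") (simp_all add: power_int_minus)
  then have "norm lam ^ nat \<bar>k\<bar> = 1" by (simp add: power_int_def)
  moreover have "norm lam ^ nat \<bar>k\<bar> > 1" using lam k by (intro one_less_power) auto
  ultimately show False by simp
qed

lemma lev_commutator: "x \<in> carrier G \<Longrightarrow> y \<in> carrier G \<Longrightarrow> lev (commutator G x y) = 0"
  by (simp add: commutator_def lev_mult lev_inv)

lemma psi_commutator:
  assumes "x \<in> carrier G" "y \<in> carrier G"
  shows "psi (commutator G x y) =
    lam powi (- lev x - lev y) * ((lam powi lev x - 1) * psi y - (lam powi lev y - 1) * psi x)"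
proof -
  define A B X Z where "A = lam powi lev x" and "B = lam powi lev y" and "X = psi x" and "Z = psi y"
  have AB: "A \<noteq> 0" "B \<noteq> 0" using lam_nz by (auto simp: A_def B_def power_int_eq_0_iff)
  have neg: "lam powi (- lev x) = 1 / A" "lam powi (- lev y) = 1 / B"
    by (simp_all add: A_def B_def power_int_minus_divide)
  have "psi (commutator G x y) =
      psi (inv x) + lam powi (- lev x) * psi (inv y) + lam powi (- lev x + - lev y) * psi x +
      lam powi (- lev y) * psi y"
    using assms by (simp add: commutator_def psi_mult lev_mult lev_inv)
  also have "lam powi (- lev x + - lev y) = 1 / A * (1 / B)"
    by (subst power_int_add) (use lam_nz in \<open>simp_all add: neg\<close>)
  also have "psi (inv x) = - (1 / A * X)" using assms by (simp only: psi_inv neg X_def)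
  also have "psi (inv y) = - (1 / B * Z)" using assms by (simp only: psi_inv neg Z_def)
  finally have "psi (commutator G x y) =
      - (1 / A * X) + 1 / A * - (1 / B * Z) + 1 / A * (1 / B) * X + 1 / B * Z"
    by (simp only: neg X_def Z_def)
  also have "\<dots> = 1 / A * (1 / B) * ((A - 1) * Z - (B - 1) * X)" using AB by (simp add: field_simps)
  also have "1 / A * (1 / B) = lam powi (- lev x - lev y)"
    unfolding diff_conv_add_uminus by (subst power_int_add) (use lam_nz in \<open>simp_all add: neg\<close>)
  finally show ?thesis by (simp only: A_def B_def X_def Z_def)
qed

text \<open>
  Commutators have level zero, so the formula for \<open>psi\<close> of a commutator shows that each outer entry
  contributes a factor that is nonzero because its level is.
\<close>

lemma psi_iter_commutator:
  assumes x: "\<And>i. i \<le> Suc r \<Longrightarrow> x i \<in> carrier G" "\<And>i. i \<le> Suc r \<Longrightarrow> lev (x i) \<noteq> 0"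
    and "psi (iter_commutator G x (Suc r)) = 0"
  shows "psi (commutator G (x 0) (x 1)) = 0"
  using assms
proof (induction r)
  case 0
  then show ?case by simp
next
  case (Suc r)
  let ?c = "iter_commutator G x (Suc r)" and ?y = "x (Suc (Suc r))"
  have c: "?c \<in> carrier G" using Suc.prems(1) by (intro iter_commutator_closed) auto
  have y: "?y \<in> carrier G" "lev ?y \<noteq> 0" using Suc.prems by auto
  have "lev ?c = 0"
    using Suc.prems(1) by (simp add: lev_commutator iter_commutator_closed)
  then have "psi (commutator G ?c ?y) = - (lam powi (- lev ?y) * (lam powi lev ?y - 1)) * psi ?c"
    using psi_commutator[OF c y(1)] by simp
  then have "psi ?c = 0"
    using Suc.prems(3) lam_powi_neq_one[OF y(2)] lam_nz by (simp add: power_int_eq_0_iff)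
  then show ?case using Suc.prems by (intro Suc.IH) auto
qed

lemma N_set_covered:
  assumes x: "x \<in> N_set G r" and r: "r \<ge> 1"
  shows "(\<exists>i<r + 1. lev (x i) = 0) \<or>
    psi (x 1) = (lam powi lev (x 1) - 1) * psi (x 0) / (lam powi lev (x 0) - 1)"
proof (cases "\<exists>i<r + 1. lev (x i) = 0")
  case False
  obtain r' where r': "r = Suc r'" using r by (cases r) auto
  have mem: "x \<in> {..<r + 1} \<rightarrow>\<^sub>E carrier G" and one: "iter_commutator G x r = \<one>"
    using x unfolding N_set_def by blast+
  have carr: "x i \<in> carrier G" if "i \<le> r" for i
    using PiE_mem[OF mem, of i] that by simp
  have "psi (commutator G (x 0) (x 1)) = 0"
  proof (rule psi_iter_commutator[of r' x])
    show "lev (x i) \<noteq> 0" if "i \<le> Suc r'" for i using False that r' by (metis Suc_eq_plus1 le_imp_less_Suc)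
    show "psi (iter_commutator G x (Suc r')) = 0" using one by (simp only: r' psi_one)
  qed (use carr r' in simp)
  then have "(lam powi lev (x 0) - 1) * psi (x 1) - (lam powi lev (x 1) - 1) * psi (x 0) = 0"
    using carr[of 0] carr[of 1] r lam_nz by (simp add: psi_commutator power_int_eq_0_iff)
  moreover have "lam powi lev (x 0) - 1 \<noteq> 0" using False lam_powi_neq_one[of "lev (x 0)"] by auto
  ultimately show ?thesis by (simp add: field_simps)
qed simp

lemma N_set_negligible:
  assumes c: "c > 1" "\<And>n. c ^ n \<le> real (card (ball n))" and r: "r \<ge> 1"
  shows "exp_negligible G Y (r + 1) (N_set G r)"
proof (rule exp_negligible_if_exp_small)
  show "N_set G r \<subseteq> {..<r + 1} \<rightarrow>\<^sub>E carrier G" by (auto simp: N_set_def)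
  obtain f where f: "exp_small f"
    "\<And>n v. real (card {g \<in> ball n. psi g = v (lev g)}) \<le> f n * real (card (ball n))"
    "\<And>n. real (card {g \<in> ball n. lev g = 0}) \<le> f n * real (card (ball n))"
    using fibre_and_kernel_negligible[OF c] by blast
  have bound: "real (card (N_set G r \<inter> ({..<r + 1} \<rightarrow>\<^sub>E ball n))) / real (card (ball n)) ^ (r + 1)
      \<le> real (r + 2) * f n" for n
  proof -
    let ?B = "{..<r + 1} \<rightarrow>\<^sub>E ball n"
    let ?Z = "\<lambda>i. {x \<in> ?B. lev (x i) = 0}"
    let ?v = "\<lambda>y k. (lam powi k - 1) * psi (y 0) / (lam powi lev (y 0) - 1)"
    let ?V = "{x \<in> ?B. psi (x 1) = ?v (restrict x ({..<r + 1} - {1})) (lev (x 1))}"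
    have fin: "finite ?B" using finite_ball by (intro finite_PiE) auto
    have Z: "real (card (?Z i)) \<le> f n * real (card (ball n)) ^ (r + 1)" if "i < r + 1" for i
      using card_PiE_coordinate[OF finite_ball that, of n "\<lambda>_ v. lev v = 0"] f(3) by blast
    have V: "real (card ?V) \<le> f n * real (card (ball n)) ^ (r + 1)"
      using r by (intro card_PiE_coordinate[OF finite_ball _ f(2)]) auto
    have "N_set G r \<inter> ?B \<subseteq> (\<Union>i<r + 1. ?Z i) \<union> ?V"
    proof
      fix x assume x: "x \<in> N_set G r \<inter> ?B"
      then show "x \<in> (\<Union>i<r + 1. ?Z i) \<union> ?V" using N_set_covered[of x r] r by auto
    qed
    then have "card (N_set G r \<inter> ?B) \<le> card ((\<Union>i<r + 1. ?Z i) \<union> ?V)"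
      using fin by (intro card_mono) auto
    also have "\<dots> \<le> card (\<Union>i<r + 1. ?Z i) + card ?V" by (rule card_Un_le)
    also have "\<dots> \<le> (\<Sum>i<r + 1. card (?Z i)) + card ?V" by (intro add_right_mono card_UN_le) auto
    finally have "real (card (N_set G r \<inter> ?B)) \<le> real ((\<Sum>i<r + 1. card (?Z i)) + card ?V)"
      by (simp only: of_nat_le_iff)
    also have "\<dots> = (\<Sum>i<r + 1. real (card (?Z i))) + real (card ?V)" by (simp only: of_nat_add of_nat_sum)
    also have "\<dots> \<le> (\<Sum>i<r + 1. f n * real (card (ball n)) ^ (r + 1)) + f n * real (card (ball n)) ^ (r + 1)"
      using Z V by (intro add_mono sum_mono) auto
    also have "\<dots> = real (r + 2) * f n * real (card (ball n)) ^ (r + 1)"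
      by (simp add: distrib_right mult.assoc)
    finally have "real (card (N_set G r \<inter> ?B)) \<le> real (r + 2) * f n * real (card (ball n)) ^ (r + 1)" .
    moreover have "real (card (ball n)) ^ (r + 1) > 0" using card_ball_pos[of n] by (intro zero_less_power) simp
    ultimately show ?thesis by (simp only: pos_divide_le_eq)
  qed
  have "exp_small (\<lambda>n. real (r + 2) * f n)" using f(1) by (rule exp_small_cmult) simp
  then show "exp_small (\<lambda>n. real (card (N_set G r \<inter> ({..<r + 1} \<rightarrow>\<^sub>E ball n))) / real (card (ball n)) ^ (r + 1))"
    using bound by (rule exp_small_mono)
qed

end

section \<open>Evaluating words in the generators\<close>

lemma pres_class_eval:
  assumes "w \<in> gwords S"
  shows "pres_class S R w = eval_gword (presented_group S R) (\<lambda>x. pres_class S R [(x, True)]) w"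
  using assms
proof (induction w)
  case Nil
  show ?case by (simp add: presented_group_def)
next
  case (Cons l w)
  interpret G: group "presented_group S R" by (rule presented_group_is_group)
  obtain x b where l: "l = (x, b)" by fastforce
  have x: "x \<in> S" and w: "w \<in> gwords S" using Cons.prems l by auto
  have carr: "pres_class S R u \<in> carrier (presented_group S R)" if "u \<in> gwords S" for u
    using that by (simp add: presented_group_def)
  have "pres_class S R ([(x, False)] @ [(x, True)]) = pres_class S R []"
    using pres_cancel[OF x, of R False] x by (subst pres_class_eq_iff) auto
  then have "pres_class S R [(x, False)] \<otimes>\<^bsub>presented_group S R\<^esub> pres_class S R [(x, True)]
      = \<one>\<^bsub>presented_group S R\<^esub>"
    using x by (subst pres_class_mult) (auto simp: presented_group_def)
  then have inv: "inv\<^bsub>presented_group S R\<^esub> pres_class S R [(x, True)] = pres_class S R [(x, False)]"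
    using x by (intro G.inv_equality carr) auto
  have "pres_class S R (l # w) = pres_class S R [l] \<otimes>\<^bsub>presented_group S R\<^esub> pres_class S R w"
    using x w l by (subst pres_class_mult) auto
  then show ?case using Cons.IH[OF w] by (cases b) (simp_all add: l inv)
qed

lemma (in group) commute_int_pow:
  assumes "x \<otimes> y = y \<otimes> x" "x \<in> carrier G" "y \<in> carrier G"
  shows "x \<otimes> y [^] (k :: int) = y [^] k \<otimes> x"
proof -
  have nat: "x \<otimes> y [^] n = y [^] n \<otimes> x" for n :: nat
  proof (induction n)
    case (Suc n)
    have "x \<otimes> y [^] Suc n = (x \<otimes> y [^] n) \<otimes> y" using assms by (simp add: m_assoc)
    also have "\<dots> = y [^] n \<otimes> (x \<otimes> y)" using assms by (simp add: Suc m_assoc)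
    also have "\<dots> = y [^] Suc n \<otimes> x" using assms by (simp add: m_assoc)
    finally show ?case .
  qed (use assms in simp)
  show ?thesis
  proof (cases k rule: int_cases2)
    case (nonneg n)
    then show ?thesis using nat by (simp add: int_pow_int)
  next
    case (nonpos n)
    let ?p = "y [^] n"
    have "inv ?p \<otimes> x = inv ?p \<otimes> (x \<otimes> ?p) \<otimes> inv ?p" using assms by (simp add: m_assoc)
    also have "\<dots> = inv ?p \<otimes> (?p \<otimes> x) \<otimes> inv ?p" by (simp only: nat)
    also have "\<dots> = (inv ?p \<otimes> ?p) \<otimes> (x \<otimes> inv ?p)"
      using assms by (simp only: m_assoc inv_closed m_closed nat_pow_closed)
    also have "\<dots> = x \<otimes> inv ?p" using assms by simp
    finally have "inv ?p \<otimes> x = x \<otimes> inv ?p" .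
    then show ?thesis using nonpos assms by (simp add: int_pow_neg_int)
  qed
qed

lemma eval_replicate:
  assumes "group H" "f x \<in> carrier H"
  shows "eval_gword H f (replicate n (x, True)) = f x [^]\<^bsub>H\<^esub> n"
    and "eval_gword H f (replicate n (x, False)) = inv\<^bsub>H\<^esub> (f x [^]\<^bsub>H\<^esub> n)"
proof -
  interpret group H by fact
  have c: "f x \<otimes>\<^bsub>H\<^esub> f x [^]\<^bsub>H\<^esub> n = f x [^]\<^bsub>H\<^esub> n \<otimes>\<^bsub>H\<^esub> f x" for n :: nat
    using assms(2) by (metis nat_pow_Suc nat_pow_Suc2)
  show "eval_gword H f (replicate n (x, True)) = f x [^]\<^bsub>H\<^esub> n"
    using assms(2) c by (induction n) auto
  show "eval_gword H f (replicate n (x, False)) = inv\<^bsub>H\<^esub> (f x [^]\<^bsub>H\<^esub> n)"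
    using assms(2) by (induction n) (auto simp: inv_mult_group)
qed

lemma eval_gen_zpow:
  assumes "group H" "f x \<in> carrier H"
  shows "eval_gword H f (gen_zpow x k) = f x [^]\<^bsub>H\<^esub> k"
proof (cases k rule: int_cases2)
  case (nonneg n)
  then show ?thesis using eval_replicate(1)[of H f x n] assms by (simp add: gen_zpow_def int_pow_int)
next
  case (nonpos n)
  interpret group H by fact
  show ?thesis
  proof (cases "n = 0")
    case True
    then show ?thesis using nonpos by (simp add: gen_zpow_def)
  next
    case False
    then have "gen_zpow x k = replicate n (x, False)" using nonpos by (simp add: gen_zpow_def)
    then show ?thesis using eval_replicate(2)[of H f x n] assms nonpos by (simp add: int_pow_neg_int)
  qed
qed

text \<open>
  The initial part of \<open>a_pow v\<close> that involves the first \<open>k\<close> generators, for induction on \<open>k\<close>.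
\<close>

definition a_prefix :: "nat \<Rightarrow> int vec \<Rightarrow> GmT_gen gword" where
  "a_prefix k v = concat (map (\<lambda>i. gen_zpow (Gen_a i) (v $ i)) [0..<k])"

lemma a_pow_prefix: "v \<in> carrier_vec m \<Longrightarrow> a_pow v = a_prefix m v"
  by (simp add: a_pow_def a_prefix_def)

lemma gen_zpow_closed: "x \<in> S \<Longrightarrow> gen_zpow x k \<in> gwords S"
  by (auto simp: gen_zpow_def gwords_def)

lemma a_prefix_closed: "k \<le> m \<Longrightarrow> a_prefix k v \<in> gwords (GmT_gens m)"
proof (induction k)
  case (Suc k)
  then show ?case
    using gen_zpow_closed[of "Gen_a k" "GmT_gens m" "v $ k"] by (auto simp: a_prefix_def GmT_gens_def)
qed (simp add: a_prefix_def)

lemma eval_a_prefix_Suc: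
  assumes "group H" "f \<in> GmT_gens m \<rightarrow> carrier H" "Suc k \<le> m"
  shows "eval_gword H f (a_prefix (Suc k) v) = eval_gword H f (a_prefix k v) \<otimes>\<^bsub>H\<^esub> f (Gen_a k) [^]\<^bsub>H\<^esub> (v $ k)"
proof -
  interpret group H by fact
  have k: "Gen_a k \<in> GmT_gens m" using assms(3) by (auto simp: GmT_gens_def)
  then have fk: "f (Gen_a k) \<in> carrier H" using assms(2) by auto
  have "a_prefix (Suc k) v = a_prefix k v @ gen_zpow (Gen_a k) (v $ k)" by (simp add: a_prefix_def)
  then show ?thesis
    using eval_gword_append[OF assms(1,2) a_prefix_closed[of k m v] gen_zpow_closed[OF k, of "v $ k"]]
      assms(3) eval_gen_zpow[of H f "Gen_a k" "v $ k"] assms(1) fk by simp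
qed

section \<open>The group of complex affine maps with multiplier a power\<close>

text \<open>
  The pair \<open>(x, i)\<close> stands for the affine map with translation part \<open>x\<close> and multiplier \<open>lam powi i\<close>.
\<close>

definition affine_group :: "complex \<Rightarrow> (complex \<times> int) monoid" where
  "affine_group lam = \<lparr>carrier = UNIV,
     monoid.mult = (\<lambda>(x, i) (y, j). (x + lam powi i * y, i + j)), monoid.one = (0, 0)\<rparr>"

lemma affine_group_simps [simp]:
  "carrier (affine_group lam) = UNIV"
  "(x, i) \<otimes>\<^bsub>affine_group lam\<^esub> (y, j) = (x + lam powi i * y, i + j)"
  "\<one>\<^bsub>affine_group lam\<^esub> = (0, 0)"
  by (simp_all add: affine_group_def)

lemma affine_group: "lam \<noteq> 0 \<Longrightarrow> group (affine_group lam)"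
proof (rule groupI)
  assume lam: "lam \<noteq> 0"
  fix x y z :: "complex \<times> int"
  show "x \<otimes>\<^bsub>affine_group lam\<^esub> y \<otimes>\<^bsub>affine_group lam\<^esub> z = x \<otimes>\<^bsub>affine_group lam\<^esub> (y \<otimes>\<^bsub>affine_group lam\<^esub> z)"
    using lam by (cases x; cases y; cases z) (simp add: power_int_add algebra_simps)
  show "\<one>\<^bsub>affine_group lam\<^esub> \<otimes>\<^bsub>affine_group lam\<^esub> x = x" by (cases x) simp
  show "\<exists>y\<in>carrier (affine_group lam). y \<otimes>\<^bsub>affine_group lam\<^esub> x = \<one>\<^bsub>affine_group lam\<^esub>"
    by (cases x, rule bexI[of _ "(- (lam powi (- snd x) * fst x), - snd x)"]) auto
qed auto

lemma affine_translation_pow: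
  assumes "lam \<noteq> 0"
  shows "(x, 0) [^]\<^bsub>affine_group lam\<^esub> (k :: int) = (of_int k * x, 0)"
proof -
  interpret group "affine_group lam" using assms by (rule affine_group)
  have nat: "(x, 0) [^]\<^bsub>affine_group lam\<^esub> n = (of_nat n * x, 0)" for n :: nat
    by (induction n) (simp_all add: algebra_simps)
  show ?thesis
  proof (cases k rule: int_cases2)
    case (nonneg n)
    then show ?thesis using nat by (simp add: int_pow_int)
  next
    case (nonpos n)
    have "inv\<^bsub>affine_group lam\<^esub> (of_nat n * x, 0) = (- (of_nat n * x), 0)"
      by (rule inv_equality) auto
    then show ?thesis using nonpos nat by (simp add: int_pow_neg_int)
  qed
qed

section \<open>The presented group as a mapping torus\<close>

definition GmT_elem :: "nat \<Rightarrow> int mat \<Rightarrow> GmT_gen \<Rightarrow> GmT_gen gword set" where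
  "GmT_elem m T x = pres_class (GmT_gens m) (GmT_rels m T) [(x, True)]"

definition GmT_apow :: "nat \<Rightarrow> int mat \<Rightarrow> int vec \<Rightarrow> GmT_gen gword set" where
  "GmT_apow m T v = pres_class (GmT_gens m) (GmT_rels m T) (a_pow v)"

lemma GmT_group: "group (GmT m T)"
  by (simp add: GmT_def presented_group_is_group)

text \<open>
  Send the \<open>i\<close>-th generator to the translation by \<open>phi i\<close> and \<open>t\<close> to the multiplication by \<open>lam\<close>. The
  relations hold because \<open>phi\<close> is a left eigenvector. The zero functional with \<open>lam = 1\<close> is also
  admitted; it still yields the level.
\<close>

lemma GmT_affine_hom:
  assumes T: "T \<in> carrier_mat m m" and lam: "lam \<noteq> 0"
    and phi: "\<And>u. u \<in> carrier_vec m \<Longrightarrow>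
      (\<Sum>i<m. phi i * of_int ((T *\<^sub>v u) $ i)) = lam * (\<Sum>i<m. phi i * of_int (u $ i))"
  shows "\<exists>h\<in>hom (GmT m T) (affine_group lam). h (GmT_elem m T Gen_t) = (0, 1) \<and>
    (\<forall>v\<in>carrier_vec m. h (GmT_apow m T v) = (\<Sum>i<m. phi i * of_int (v $ i), 0))"
proof -
  interpret H: group "affine_group lam" using lam by (rule affine_group)
  define f where "f x = (case x of Gen_a i \<Rightarrow> (phi i, 0 :: int) | Gen_t \<Rightarrow> (0, 1))" for x
  have f: "f \<in> GmT_gens m \<rightarrow> carrier (affine_group lam)" by simp
  have f_gens: "f (Gen_a i) = (phi i, 0)" "f Gen_t = (0, 1)" for i by (simp_all add: f_def)
  have prefix: "k \<le> m \<Longrightarrow> eval_gword (affine_group lam) f (a_prefix k v)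
      = (\<Sum>i<k. phi i * of_int (v $ i), 0)" for k v
  proof (induction k)
    case (Suc k)
    then show ?case
      using eval_a_prefix_Suc[OF H.group_axioms f, of k v] affine_translation_pow[OF lam, of "phi k" "v $ k"]
      by (simp add: f_gens mult.commute)
  qed (simp add: a_prefix_def)
  have apow: "eval_gword (affine_group lam) f (a_pow v) = (\<Sum>i<m. phi i * of_int (v $ i), 0)"
    if "v \<in> carrier_vec m" for v
    using prefix[of m v] a_pow_prefix[OF that] by simp
  have "eval_gword (affine_group lam) f u = eval_gword (affine_group lam) f v"
    if uv: "(u, v) \<in> GmT_rels m T" "u \<in> gwords (GmT_gens m)" "v \<in> gwords (GmT_gens m)" for u v
  proof -
    from uv(1) consider
      i j where "u = [(Gen_a i, True), (Gen_a j, True)]" "v = [(Gen_a j, True), (Gen_a i, True)]"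
      | z where "z \<in> carrier_vec m" "u = [(Gen_t, True)] @ a_pow z @ [(Gen_t, False)]" "v = a_pow (T *\<^sub>v z)"
      unfolding GmT_rels_def by blast
    then show ?thesis
    proof cases
      case 1
      then show ?thesis by (simp add: f_gens)
    next
      case 2
      have inv: "inv\<^bsub>affine_group lam\<^esub> (0, 1) = (0, - 1)" by (rule H.inv_equality) auto
      have "a_pow z \<in> gwords (GmT_gens m)" "[(Gen_t, False)] \<in> gwords (GmT_gens m)"
        using a_prefix_closed[of m m z] a_pow_prefix[OF 2(1)] by (auto simp: GmT_gens_def)
      then have "eval_gword (affine_group lam) f u = (lam * (\<Sum>i<m. phi i * of_int (z $ i)), 0)"
        using eval_gword_append[OF H.group_axioms f, of "a_pow z" "[(Gen_t, False)]"] apow[OF 2(1)]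
        by (simp add: 2(2) f_gens inv)
      moreover have "T *\<^sub>v z \<in> carrier_vec m" using T 2(1) by simp
      ultimately show ?thesis using apow phi[OF 2(1)] by (simp add: 2(3))
    qed
  qed
  from presented_group_universal[OF H.group_axioms f this]
  obtain h where h: "h \<in> hom (GmT m T) (affine_group lam)"
    "\<And>w. w \<in> gwords (GmT_gens m) \<Longrightarrow>
       h (pres_class (GmT_gens m) (GmT_rels m T) w) = eval_gword (affine_group lam) f w"
    unfolding GmT_def by blast
  have "h (GmT_elem m T Gen_t) = (0, 1)"
    unfolding GmT_elem_def by (subst h(2)) (auto simp: GmT_gens_def f_gens)
  moreover have "h (GmT_apow m T v) = (\<Sum>i<m. phi i * of_int (v $ i), 0)" if v: "v \<in> carrier_vec m" for v
  proof -
    have "a_pow v \<in> gwords (GmT_gens m)" using a_prefix_closed[of m m v] by (simp add: a_pow_prefix[OF v])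
    then show ?thesis unfolding GmT_apow_def by (simp only: h(2) apow[OF v])
  qed
  ultimately show ?thesis using h(1) by blast
qed

text \<open>
  The commutation relations make \<open>a\<^sup>v\<close> additive in \<open>v\<close>, one generator at a time.
\<close>

lemma GmT_mapping_torus:
  assumes T: "T \<in> carrier_mat m m"
    and lev: "\<And>x y. x \<in> carrier (GmT m T) \<Longrightarrow> y \<in> carrier (GmT m T) \<Longrightarrow>
      lev (x \<otimes>\<^bsub>GmT m T\<^esub> y) = lev x + lev y"
      "lev (GmT_elem m T Gen_t) = 1" "\<And>v. v \<in> carrier_vec m \<Longrightarrow> lev (GmT_apow m T v) = 0"
  shows "mapping_torus (GmT m T) m T (GmT_elem m T Gen_t) (GmT_apow m T) lev"
proof -
  let ?S = "GmT_gens m" and ?R = "GmT_rels m T"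
  define G where "G = GmT m T"
  define g where "g = GmT_elem m T"
  define t where "t = GmT_elem m T Gen_t"
  define E where "E = GmT_apow m T"
  interpret G: group G unfolding G_def by (rule GmT_group)
  have carr: "pres_class ?S ?R w \<in> carrier G" if "w \<in> gwords ?S" for w
    using that by (simp add: G_def GmT_def presented_group_def)
  have g: "g \<in> ?S \<rightarrow> carrier G" by (auto simp: g_def GmT_elem_def intro!: carr)
  have ev: "pres_class ?S ?R w = eval_gword G g w" if "w \<in> gwords ?S" for w
    using pres_class_eval[OF that] by (simp add: G_def GmT_def g_def GmT_elem_def[abs_def])
  have apow: "a_pow v \<in> gwords ?S" if "v \<in> carrier_vec m" for v
    using a_prefix_closed[of m m v] a_pow_prefix[OF that] by simp
  have E: "E v = eval_gword G g (a_prefix m v)" "E v \<in> carrier G" if "v \<in> carrier_vec m" for v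
    using ev[OF apow[OF that]] carr[OF apow[OF that]] a_pow_prefix[OF that] by (simp_all add: E_def GmT_apow_def)
  have rel: "eval_gword G g u = eval_gword G g v"
    if "(u, v) \<in> ?R" "u \<in> gwords ?S" "v \<in> gwords ?S" for u v
    using pres_class_eq_iff[OF that(2)] pres_rel[OF that] ev that by metis
  have tS: "Gen_t \<in> ?S" by (simp add: GmT_gens_def)
  then have t: "t \<in> carrier G" "t = g Gen_t" using g by (auto simp: t_def g_def)
  have a: "g (Gen_a i) \<in> carrier G" if "i < m" for i
    using that g by (auto simp: GmT_gens_def)
  have comm: "g (Gen_a i) \<otimes>\<^bsub>G\<^esub> g (Gen_a j) = g (Gen_a j) \<otimes>\<^bsub>G\<^esub> g (Gen_a i)" if ij: "i < m" "j < m" for i j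
  proof -
    have *: "g (Gen_a i) \<otimes>\<^bsub>G\<^esub> g (Gen_a j) = g (Gen_a j) \<otimes>\<^bsub>G\<^esub> g (Gen_a i)" if "i < j" "j < m" for i j
      using rel[of "[(Gen_a i, True), (Gen_a j, True)]" "[(Gen_a j, True), (Gen_a i, True)]"] that a[of i] a[of j]
      by (simp add: GmT_rels_def GmT_gens_def)
    show ?thesis using *[of i j] *[of j i] ij by (cases i j rule: linorder_cases) auto
  qed
  let ?P = "\<lambda>k v. eval_gword G g (a_prefix k v)"
  have P: "?P k v \<in> carrier G" if "k \<le> m" for k v
    using eval_gword_closed[OF G.group_axioms g a_prefix_closed[OF that]] .
  have P_Suc: "?P (Suc k) v = ?P k v \<otimes>\<^bsub>G\<^esub> g (Gen_a k) [^]\<^bsub>G\<^esub> (v $ k)" if "k < m" for k v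
    using eval_a_prefix_Suc[OF G.group_axioms g] that by simp
  have P_0: "?P 0 v = \<one>\<^bsub>G\<^esub>" for v by (simp add: a_prefix_def)
  have P_comm: "k \<le> m \<Longrightarrow> j < m \<Longrightarrow> ?P k v \<otimes>\<^bsub>G\<^esub> g (Gen_a j) = g (Gen_a j) \<otimes>\<^bsub>G\<^esub> ?P k v" for k j v
  proof (induction k)
    case 0
    then show ?case using a[of j] by (simp add: P_0)
  next
    case (Suc k)
    let ?a = "g (Gen_a j)" and ?p = "g (Gen_a k) [^]\<^bsub>G\<^esub> (v $ k)"
    have c: "?a \<in> carrier G" "?p \<in> carrier G" "?P k v \<in> carrier G" using Suc.prems a P by auto
    have ap: "?a \<otimes>\<^bsub>G\<^esub> ?p = ?p \<otimes>\<^bsub>G\<^esub> ?a"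
      using Suc.prems comm a by (intro G.commute_int_pow) auto
    have "?P (Suc k) v \<otimes>\<^bsub>G\<^esub> ?a = ?P k v \<otimes>\<^bsub>G\<^esub> (?p \<otimes>\<^bsub>G\<^esub> ?a)"
      using Suc.prems c by (simp add: P_Suc G.m_assoc)
    also have "\<dots> = (?P k v \<otimes>\<^bsub>G\<^esub> ?a) \<otimes>\<^bsub>G\<^esub> ?p" using c by (simp add: G.m_assoc flip: ap)
    also have "\<dots> = ?a \<otimes>\<^bsub>G\<^esub> ?P (Suc k) v" using Suc c by (simp add: P_Suc G.m_assoc)
    finally show ?case .
  qed
  have P_add: "k \<le> m \<Longrightarrow> ?P k (u + v) = ?P k u \<otimes>\<^bsub>G\<^esub> ?P k v"
    if uv: "u \<in> carrier_vec m" "v \<in> carrier_vec m" for k u v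
  proof (induction k)
    case 0
    then show ?case by (simp add: P_0)
  next
    case (Suc k)
    let ?p = "g (Gen_a k) [^]\<^bsub>G\<^esub> (u $ k)" and ?q = "g (Gen_a k) [^]\<^bsub>G\<^esub> (v $ k)"
    have k: "k < m" using Suc.prems by simp
    have c: "?p \<in> carrier G" "?q \<in> carrier G" "?P k u \<in> carrier G" "?P k v \<in> carrier G"
      using k a P by auto
    have vp: "?P k v \<otimes>\<^bsub>G\<^esub> ?p = ?p \<otimes>\<^bsub>G\<^esub> ?P k v"
      using k a P P_comm by (intro G.commute_int_pow) auto
    have "(u + v) $ k = u $ k + v $ k" using uv k by simp
    then have "?P (Suc k) (u + v) = ?P k u \<otimes>\<^bsub>G\<^esub> ?P k v \<otimes>\<^bsub>G\<^esub> (?p \<otimes>\<^bsub>G\<^esub> ?q)"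
      using k Suc a[OF k] by (simp add: P_Suc G.int_pow_mult)
    also have "\<dots> = ?P k u \<otimes>\<^bsub>G\<^esub> (?P k v \<otimes>\<^bsub>G\<^esub> ?p) \<otimes>\<^bsub>G\<^esub> ?q" using c by (simp add: G.m_assoc)
    also have "\<dots> = ?P (Suc k) u \<otimes>\<^bsub>G\<^esub> ?P (Suc k) v" using c k by (simp add: vp P_Suc G.m_assoc)
    finally show ?case .
  qed
  have P_unit: "k \<le> m \<Longrightarrow> ?P k (unit_vec m i) = (if i < k then g (Gen_a i) else \<one>\<^bsub>G\<^esub>)" if i: "i < m" for k i
  proof (induction k)
    case (Suc k)
    have "g (Gen_a k) [^]\<^bsub>G\<^esub> (unit_vec m i $ k :: int) = (if k = i then g (Gen_a k) else \<one>\<^bsub>G\<^esub>)"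
      using Suc.prems i a[of k] by auto
    then show ?case using Suc a[OF i] by (auto simp: P_Suc)
  qed (simp add: P_0)
  have tE: "t \<otimes>\<^bsub>G\<^esub> E v = E (T *\<^sub>v v) \<otimes>\<^bsub>G\<^esub> t" if v: "v \<in> carrier_vec m" for v
  proof -
    have Tv: "T *\<^sub>v v \<in> carrier_vec m" using T v by simp
    have "eval_gword G g ([(Gen_t, True)] @ a_pow v @ [(Gen_t, False)]) = eval_gword G g (a_pow (T *\<^sub>v v))"
      using v Tv tS apow by (intro rel) (auto simp: GmT_rels_def)
    then have "t \<otimes>\<^bsub>G\<^esub> (E v \<otimes>\<^bsub>G\<^esub> inv\<^bsub>G\<^esub> t) = E (T *\<^sub>v v)"
      using eval_gword_append[OF G.group_axioms g apow[OF v], of "[(Gen_t, False)]"] tS t E[OF v] E[OF Tv]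
      by (simp add: a_pow_prefix[OF v] a_pow_prefix[OF Tv])
    then have "E (T *\<^sub>v v) \<otimes>\<^bsub>G\<^esub> t = t \<otimes>\<^bsub>G\<^esub> (E v \<otimes>\<^bsub>G\<^esub> inv\<^bsub>G\<^esub> t) \<otimes>\<^bsub>G\<^esub> t" by simp
    also have "\<dots> = t \<otimes>\<^bsub>G\<^esub> E v" using t(1) E(2)[OF v] by (simp add: G.m_assoc)
    finally show ?thesis by simp
  qed
  let ?X = "insert t (E ` carrier_vec m)"
  have X: "?X \<subseteq> carrier G" using t E by auto
  have gX: "g x \<in> generate G ?X" if "x \<in> ?S" for x
  proof (cases x)
    case Gen_t
    then show ?thesis using t by (auto intro: generate.incl)
  next
    case (Gen_a i)
    then have i: "i < m" using that by (auto simp: GmT_gens_def)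
    have "E (unit_vec m i) = g x" using E(1)[of "unit_vec m i"] P_unit[OF i, of m] i Gen_a by simp
    then show ?thesis by (metis generate.incl image_eqI insertI2 unit_vec_carrier)
  qed
  have gen: "w \<in> gwords ?S \<Longrightarrow> eval_gword G g w \<in> generate G ?X" for w
  proof (induction w)
    case (Cons l w)
    have "inv\<^bsub>G\<^esub> g x \<in> generate G ?X" if "x \<in> ?S" for x
      using G.generate_m_inv_closed[OF X gX[OF that]] .
    then show ?case using Cons gX by (auto intro!: generate.eng)
  qed (auto intro: generate.one)
  have "carrier G \<subseteq> generate G ?X"
  proof
    fix z assume "z \<in> carrier G"
    then obtain w where "w \<in> gwords ?S" "z = pres_class ?S ?R w"
      by (auto simp: G_def GmT_def presented_group_def)
    then show "z \<in> generate G ?X" using gen ev by simp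
  qed
  then have "generate G ?X = carrier G" using G.generate_incl[OF X] by blast
  then have "mapping_torus G m T t E lev"
    using T t E tE P_add[of _ _ m] lev unfolding G_def[symmetric] t_def[symmetric] E_def[symmetric]
    by (intro mapping_torus.intro mapping_torus_axioms.intro G.group_axioms) auto
  then show ?thesis by (simp add: G_def t_def E_def)
qed

section \<open>Negligibility\<close>

theorem theorem2p9:
  fixes m r :: nat and T :: "int mat" and Y :: "GmT_gen gword set set"
  assumes "m \<ge> 1"
    and "T \<in> carrier_mat m m"
    and "det T \<noteq> 0"
    and "r \<ge> 1"
    and "exponential_growth (GmT m T)"
    and "finite_generating_set (GmT m T) Y"
  shows "exp_negligible (GmT m T) Y (r + 1) (N_set (GmT m T) r)"
proof -
  note T = assms(2)
  interpret G: group "GmT m T" by (rule GmT_group)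
  have torus: "mapping_torus (GmT m T) m T (GmT_elem m T Gen_t) (GmT_apow m T) (\<lambda>g. snd (h g))"
    if h: "h \<in> hom (GmT m T) (affine_group lam)" "h (GmT_elem m T Gen_t) = (0, 1)"
      "\<forall>v\<in>carrier_vec m. h (GmT_apow m T v) = (\<Sum>i<m. phi i * of_int (v $ i), 0)" for h lam phi
  proof (rule GmT_mapping_torus[OF T])
    fix x y assume "x \<in> carrier (GmT m T)" "y \<in> carrier (GmT m T)"
    then have "h (x \<otimes>\<^bsub>GmT m T\<^esub> y) = h x \<otimes>\<^bsub>affine_group lam\<^esub> h y" using h(1) by (rule hom_mult[rotated 1])
    then show "snd (h (x \<otimes>\<^bsub>GmT m T\<^esub> y)) = snd (h x) + snd (h y)" by (cases "h x"; cases "h y") simp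
  qed (use h in auto)
  obtain Y' c where Y': "finite_generating_set (GmT m T) Y'" and c: "c > 1"
    and ev: "eventually (\<lambda>n. c ^ n \<le> real (card (word_ball (GmT m T) Y' n))) sequentially"
    using assms(5) by (rule exponential_growthE)
  have "\<not> (\<exists>a d. \<forall>i p q. p < m \<longrightarrow> q < m \<longrightarrow> \<bar>(T ^\<^sub>m i) $$ (p, q)\<bar> \<le> int (a * (i + 1) ^ d))"
  proof
    assume "\<exists>a d. \<forall>i p q. p < m \<longrightarrow> q < m \<longrightarrow> \<bar>(T ^\<^sub>m i) $$ (p, q)\<bar> \<le> int (a * (i + 1) ^ d)"
    then obtain a d where ad: "\<And>i p q. p < m \<Longrightarrow> q < m \<Longrightarrow> \<bar>(T ^\<^sub>m i) $$ (p, q)\<bar> \<le> int (a * (i + 1) ^ d)"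
      by blast
    \<comment> \<open>The zero functional with multiplier one provides the level.\<close>
    obtain h where h: "h \<in> hom (GmT m T) (affine_group 1)" "h (GmT_elem m T Gen_t) = (0, 1)"
      "\<forall>v\<in>carrier_vec m. h (GmT_apow m T v) = (\<Sum>i<m. 0 * of_int (v $ i), 0)"
      using GmT_affine_hom[OF T, of 1 "\<lambda>_. 0"] by auto
    interpret mapping_torus "GmT m T" m T "GmT_elem m T Gen_t" "GmT_apow m T" "\<lambda>g. snd (h g)"
      using h by (rule torus)
    interpret fg_mapping_torus "GmT m T" m T "GmT_elem m T Gen_t" "GmT_apow m T" "\<lambda>g. snd (h g)" Y'
      by unfold_locales (rule Y')
    obtain C q where C: "0 \<le> C" "0 < q" "q < 1" "\<And>n. real (card (ball n)) * (1 / c) ^ n \<le> C * q ^ n"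
      using subexponential_growth[OF ad c] unfolding exp_small_def by blast
    have "(\<lambda>n. C * q ^ n) \<longlonglongrightarrow> C * 0" using C by (intro tendsto_mult tendsto_const LIMSEQ_realpow_zero) auto
    then have "eventually (\<lambda>n. C * q ^ n < 1) sequentially" by (intro order_tendstoD(2)) auto
    with ev have "eventually (\<lambda>n. False) sequentially"
    proof eventually_elim
      case (elim n)
      have "1 = c ^ n * (1 / c) ^ n" using c by (simp flip: power_mult_distrib)
      also have "\<dots> \<le> real (card (ball n)) * (1 / c) ^ n" using elim(1) c by (intro mult_right_mono) auto
      also have "\<dots> < 1" using C(4)[of n] elim(2) by linarith
      finally show False by simp
    qed
    then show False by simp
  qed
  then obtain lam phi where lam: "norm lam > 1" and i: "\<exists>i<m. phi i \<noteq> 0"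
    and phi: "\<And>u. u \<in> carrier_vec m \<Longrightarrow>
      (\<Sum>i<m. phi i * complex_of_int ((T *\<^sub>v u) $ i)) = lam * (\<Sum>i<m. phi i * of_int (u $ i))"
    using expanding_eigenvector_or_poly_powers[OF T assms(1)] by blast
  have lam0: "lam \<noteq> 0" using lam by auto
  obtain h where h: "h \<in> hom (GmT m T) (affine_group lam)" "h (GmT_elem m T Gen_t) = (0, 1)"
    "\<forall>v\<in>carrier_vec m. h (GmT_apow m T v) = (\<Sum>i<m. phi i * of_int (v $ i), 0)"
    using GmT_affine_hom[OF T lam0 phi] by auto
  obtain i where i: "i < m" "phi i \<noteq> 0" using i by blast
  interpret mapping_torus "GmT m T" m T "GmT_elem m T Gen_t" "GmT_apow m T" "\<lambda>g. snd (h g)"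
    using h by (rule torus)
  interpret fg_mapping_torus "GmT m T" m T "GmT_elem m T Gen_t" "GmT_apow m T" "\<lambda>g. snd (h g)" Y
    by unfold_locales (rule assms(6))
  have "fst (h (GmT_apow m T (unit_vec m i))) = (\<Sum>j<m. phi j * of_int (unit_vec m i $ j))"
    using h(3) by simp
  also have "\<dots> = (\<Sum>j<m. if j = i then phi j else 0)" using i by (intro sum.cong) auto
  finally have "fst (h (GmT_apow m T (unit_vec m i))) = (\<Sum>j<m. if j = i then phi j else 0)" .
  then have unit: "fst (h (GmT_apow m T (unit_vec m i))) \<noteq> 0" using i by simp
  interpret expanding_mapping_torus "GmT m T" m T "GmT_elem m T Gen_t" "GmT_apow m T" "\<lambda>g. snd (h g)" Y
    lam "\<lambda>g. fst (h g)" "GmT_apow m T (unit_vec m i)"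
  proof
    fix x y assume "x \<in> carrier (GmT m T)" "y \<in> carrier (GmT m T)"
    then have "h (x \<otimes>\<^bsub>GmT m T\<^esub> y) = h x \<otimes>\<^bsub>affine_group lam\<^esub> h y" using h(1) by (rule hom_mult[rotated 1])
    then show "fst (h (x \<otimes>\<^bsub>GmT m T\<^esub> y)) = fst (h x) + lam powi snd (h x) * fst (h y)"
      by (cases "h x"; cases "h y") simp
  qed (use lam unit lev_E in auto)
  obtain d where "d > 1" "\<And>n. d ^ n \<le> real (card (ball n))"
    using growth_transfer[OF Y' c ev] by blast
  then show ?thesis using assms(4) by (rule N_set_negligible)
qed

end
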